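(* For every $\Delta$ there exists $L=L(\Delta)$ such that the following holds for every $n$. Let $q\in[0,1]$, let $H$ be a $q$-sparse graph on $n$ vertices, let $p=Lq$, and let $F$ be a tree with maximum degree $\Delta$ (of any size, possibly depending on $n$). Then \[ N(H,F) < \mathbb{E}_pX_F. \]
   Context: All graphs are simple. A copy of a graph $J$ in a graph $G$ is an unlabeled subgraph of $G$ isomorphic to $J$, and $N(G,J)$ denotes the number of copies of $J$ in $G$. $G_{n,p}$ is the Erdős–Rényi random graph on $n$ vertices, and $\mathbb{E}_pX_J:=\mathbb{E}\,N(G_{n,p},J)=N(K_n,J)p^{e_J}$, where $e_J$ is the number of edges of $J$. A graph $H$ on $n$ vertices (i.e. a subgraph of $K_n$) is $q$-sparse if $\mathbb{E}_qX_I\ge 1$ for every subgraph $I\subseteq H$.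
   Formalization: Assumes Δ ≥ 1, q > 0 and that F has at most n vertices: otherwise the strict inequality fails, since both sides equal n (Δ = 0, F a single vertex) or both are 0 (q = 0, or F has more than n vertices). *)

theory Defs
  imports "HOL-Probability.Probability"
begin

datatype 'a ugraph = Graph (verts: "'a set") (edges: "'a set set")

definition simple_graph :: "'a ugraph \<Rightarrow> bool" where
  "simple_graph G \<longleftrightarrow> finite (verts G) \<and> (\<forall>e\<in>edges G. e \<subseteq> verts G \<and> card e = 2)"

definition subgraph :: "'a ugraph \<Rightarrow> 'a ugraph \<Rightarrow> bool" where
  "subgraph I H \<longleftrightarrow> simple_graph I \<and> simple_graph H \<and>
     verts I \<subseteq> verts H \<and> edges I \<subseteq> edges H"

definition isomorphic :: "'a ugraph \<Rightarrow> 'b ugraph \<Rightarrow> bool" where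
  "isomorphic G H \<longleftrightarrow>
     (\<exists>f. bij_betw f (verts G) (verts H) \<and> edges H = (\<lambda>e. f ` e) ` edges G)"

definition complete_ugraph :: "nat \<Rightarrow> nat ugraph" where
  "complete_ugraph n = Graph {..<n} {e. e \<subseteq> {..<n} \<and> card e = 2}"

definition copies :: "'a ugraph \<Rightarrow> 'b ugraph \<Rightarrow> 'a ugraph set" where
  "copies G J = {C. subgraph C G \<and> isomorphic C J}"

definition num_copies :: "'a ugraph \<Rightarrow> 'b ugraph \<Rightarrow> nat" where
  "num_copies G J = card (copies G J)"

text \<open>The closed formula is taken as the definition because it is also used for \<open>p > 1\<close>,
  where \<open>G\<^sub>n\<^sub>,\<^sub>p\<close> does not exist; for \<open>0 \<le> p \<le> 1\<close> it agrees with the expected number of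
  copies in \<open>G\<^sub>n\<^sub>,\<^sub>p\<close>, see \<open>expectation_num_copies\<close> below.\<close>

definition expected_copies :: "nat \<Rightarrow> real \<Rightarrow> 'b ugraph \<Rightarrow> real" where
  "expected_copies n p J = real (num_copies (complete_ugraph n) J) * p ^ card (edges J)"

definition q_sparse :: "nat \<Rightarrow> real \<Rightarrow> nat ugraph \<Rightarrow> bool" where
  "q_sparse n q H \<longleftrightarrow> (\<forall>I. subgraph I H \<longrightarrow> expected_copies n q I \<ge> 1)"

definition vertex_degree :: "'a ugraph \<Rightarrow> 'a \<Rightarrow> nat" where
  "vertex_degree G v = card {e \<in> edges G. v \<in> e}"

definition max_degree :: "'a ugraph \<Rightarrow> nat" where
  "max_degree G = Max (vertex_degree G ` verts G)"

definition connected_graph :: "'a ugraph \<Rightarrow> bool" where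
  "connected_graph G \<longleftrightarrow> verts G \<noteq> {} \<and>
     (\<forall>u\<in>verts G. \<forall>v\<in>verts G. (u, v) \<in> {(x, y). {x, y} \<in> edges G}\<^sup>*)"

definition is_cycle :: "'a ugraph \<Rightarrow> 'a list \<Rightarrow> bool" where
  "is_cycle G xs \<longleftrightarrow> 3 \<le> length xs \<and> distinct xs \<and>
     (\<forall>i<length xs. {xs ! i, xs ! (Suc i mod length xs)} \<in> edges G)"

definition is_tree :: "'a ugraph \<Rightarrow> bool" where
  "is_tree G \<longleftrightarrow> simple_graph G \<and> connected_graph G \<and> (\<nexists>xs. is_cycle G xs)"

definition random_graph :: "nat \<Rightarrow> real \<Rightarrow> nat ugraph pmf" where
  "random_graph n p =
     map_pmf (\<lambda>b. Graph {..<n} {e \<in> edges (complete_ugraph n). b e})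
       (Pi_pmf (edges (complete_ugraph n)) False (\<lambda>_. bernoulli_pmf p))"

lemma simple_complete_ugraph: "simple_graph (complete_ugraph n)"
  by (auto simp: simple_graph_def complete_ugraph_def)

lemma finite_edges: "simple_graph G \<Longrightarrow> finite (edges G)"
  by (rule finite_subset[of _ "Pow (verts G)"]) (auto simp: simple_graph_def)

lemma finite_copies:
  assumes "simple_graph G"
  shows "finite (copies G J)"
proof (rule finite_subset)
  show "copies G J \<subseteq> (\<lambda>(V, E). Graph V E) ` (Pow (verts G) \<times> Pow (edges G))"
  proof
    fix C assume "C \<in> copies G J"
    then have "(verts C, edges C) \<in> Pow (verts G) \<times> Pow (edges G)"
      by (auto simp: copies_def subgraph_def)
    then show "C \<in> (\<lambda>(V, E). Graph V E) ` (Pow (verts G) \<times> Pow (edges G))"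
      by (intro image_eqI[of _ _ "(verts C, edges C)"]) auto
  qed
  show "finite ((\<lambda>(V, E). Graph V E) ` (Pow (verts G) \<times> Pow (edges G)))"
    using assms finite_edges[OF assms] by (auto simp: simple_graph_def)
qed

lemma isomorphic_card_edges:
  assumes "simple_graph C" "isomorphic C J"
  shows "card (edges J) = card (edges C)"
proof -
  obtain f where f: "bij_betw f (verts C) (verts J)" "edges J = (\<lambda>e. f ` e) ` edges C"
    using assms(2) by (auto simp: isomorphic_def)
  have "inj_on ((`) f) (Pow (verts C))"
    using f(1) by (simp add: bij_betw_def inj_on_image_Pow)
  then have "inj_on ((`) f) (edges C)"
    by (rule inj_on_subset) (use assms(1) in \<open>auto simp: simple_graph_def\<close>)
  then show ?thesis using f(2) by (simp add: card_image)
qed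

lemma prob_subset_Pi_bernoulli:
  assumes "finite A" "S \<subseteq> A" "0 \<le> p" "p \<le> 1"
  shows "measure_pmf.prob (Pi_pmf A False (\<lambda>_. bernoulli_pmf p)) {b. \<forall>e\<in>S. b e} = p ^ card S"
proof -
  let ?M = "Pi_pmf A False (\<lambda>_. bernoulli_pmf p)"
  let ?B = "\<lambda>e. if e \<in> S then {True} else UNIV"
  have "measure_pmf.prob ?M {b. \<forall>e\<in>S. b e} = measure_pmf.prob ?M (PiE_dflt A False ?B)"
  proof (rule measure_pmf.finite_measure_eq_AE)
    show "AE b in ?M. (b \<in> {b. \<forall>e\<in>S. b e}) = (b \<in> PiE_dflt A False ?B)"
      using assms(2) set_Pi_pmf_subset'[OF assms(1), of False "\<lambda>_. bernoulli_pmf p"]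
      by (auto simp: AE_measure_pmf_iff PiE_dflt_def)
  qed auto
  also have "\<dots> = (\<Prod>e\<in>A. measure_pmf.prob (bernoulli_pmf p) (?B e))"
    by (rule measure_Pi_pmf_PiE_dflt[OF assms(1)])
  also have "\<dots> = (\<Prod>e\<in>A. if e \<in> S then p else 1)"
    using assms(3,4) by (intro prod.cong) (auto simp: measure_pmf_single)
  also have "\<dots> = p ^ card S"
    using assms(1,2) by (simp add: prod.If_cases Int_absorb1)
  finally show ?thesis .
qed

lemma expectation_num_copies:
  assumes "0 \<le> p" "p \<le> 1"
  shows "measure_pmf.expectation (random_graph n p) (\<lambda>G. real (num_copies G J)) =
           expected_copies n p J"
proof -
  let ?K = "complete_ugraph n"
  let ?M = "Pi_pmf (edges ?K) False (\<lambda>_. bernoulli_pmf p)"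
  let ?G = "\<lambda>b. Graph {..<n} {e \<in> edges ?K. b e}"
  have fin: "finite (copies ?K J)" "finite (edges ?K)"
    by (simp_all add: finite_copies finite_edges simple_complete_ugraph)
  have cop: "copies (?G b) J = {C \<in> copies ?K J. \<forall>e\<in>edges C. b e}" for b
    by (auto simp: copies_def subgraph_def simple_graph_def complete_ugraph_def)
  have "real (num_copies (?G b) J) =
      (\<Sum>C\<in>copies ?K J. indicator {b. \<forall>e\<in>edges C. b e} b)" for b
    using fin(1) by (simp add: num_copies_def cop indicator_def sum.If_cases Int_def)
  then have "measure_pmf.expectation (random_graph n p) (\<lambda>G. real (num_copies G J)) =
      measure_pmf.expectation ?M (\<lambda>b. \<Sum>C\<in>copies ?K J. indicator {b. \<forall>e\<in>edges C. b e} b)"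
    by (simp add: random_graph_def)
  also have "\<dots> = (\<Sum>C\<in>copies ?K J. measure_pmf.prob ?M {b. \<forall>e\<in>edges C. b e})"
    by (subst Bochner_Integration.integral_sum)
      (auto intro!: measure_pmf.integrable_const_bound[where B = 1] simp: indicator_def)
  also have "\<dots> = (\<Sum>C\<in>copies ?K J. p ^ card (edges J))"
  proof (rule sum.cong[OF refl])
    fix C assume "C \<in> copies ?K J"
    then have "edges C \<subseteq> edges ?K" "card (edges J) = card (edges C)"
      using isomorphic_card_edges[of C J] by (auto simp: copies_def subgraph_def)
    then show "measure_pmf.prob ?M {b. \<forall>e\<in>edges C. b e} = p ^ card (edges J)"
      using prob_subset_Pi_bernoulli[OF fin(2) _ assms, of "edges C"] by simp
  qed
  finally show ?thesis by (simp add: expected_copies_def num_copies_def)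
qed

end

theory Submission
  imports Defs
begin

text \<open>Write \<open>v\<close> for the number of vertices of the tree \<open>F\<close>, and \<open>\<Lambda> = max 1 (n q)\<close>. Comparing numbers of
  embeddings instead of copies, it is enough to find at most \<open>n (n q)\<^sup>v\<^sup>-\<^sup>1 C\<^sup>v\<close> embeddings of
  \<open>F\<close> into \<open>H\<close>. Let the level of an embedding be the logarithm of the product of the ratios
  \<open>deg / (K \<Lambda>)\<close> over those of its vertices for which this exceeds \<open>1\<close>. There are at most
  \<open>(K \<Lambda>)\<^sup>v\<^sup>-\<^sup>1 exp (\<Delta> b)\<close> rooted embeddings of level at most \<open>b\<close>; if \<open>n q > 1\<close> this settles all levels
  up to \<open>v\<close>.

  For the embeddings of a level about \<open>j\<close>, take a maximal vertex-disjoint family \<open>\<M>\<close> of them. Every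
  embedding of this level meets a member of \<open>\<M>\<close>, so it suffices to bound \<open>card \<M>\<close>. The union of the
  trees in \<open>\<M>\<close> together with the edges of \<open>H\<close> at their vertices of large degree is a subgraph of \<open>H\<close>,
  and hence has expectation at least \<open>1\<close>. Its copies are sets of \<open>card \<M>\<close> decorated trees, so the
  expectation is at most \<open>exp (e Z - card \<M>)\<close> where \<open>Z\<close> is the weighted number of decorated trees,
  and \<open>card \<M> \<le> e Z\<close>. The stars at vertices of large degree are so unlikely that \<open>Z\<close> beats the loss
  incurred by passing to \<open>\<M>\<close>.\<close>

subsection \<open>Neighbourhoods, trees and embeddings\<close>

definition nbrs :: "'a ugraph \<Rightarrow> 'a \<Rightarrow> 'a set" where
  "nbrs G x = {y. {x, y} \<in> edges G}"

definition induced :: "'a ugraph \<Rightarrow> 'a set \<Rightarrow> 'a ugraph" where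
  "induced G P = Graph P {e \<in> edges G. e \<subseteq> P}"

lemma verts_induced [simp]: "verts (induced G P) = P"
  and edges_induced [simp]: "edges (induced G P) = {e \<in> edges G. e \<subseteq> P}"
  by (simp_all add: induced_def)

lemma edge_in_verts:
  assumes "simple_graph G" "{x, y} \<in> edges G"
  shows "x \<in> verts G" "y \<in> verts G" "x \<noteq> y"
  using assms by (auto simp: simple_graph_def)

lemma finite_nbrs: "simple_graph G \<Longrightarrow> finite (nbrs G x)"
  by (rule finite_subset[of _ "verts G"]) (auto simp: nbrs_def simple_graph_def)

lemma induced_verts: "simple_graph G \<Longrightarrow> induced G (verts G) = G"
  by (cases G) (auto simp: induced_def simple_graph_def)

lemma incident_edges:
  assumes "simple_graph G"
  shows "{e \<in> edges G. x \<in> e} = (\<lambda>y. {x, y}) ` nbrs G x"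
proof (intro equalityI subsetI)
  fix e assume "e \<in> {e \<in> edges G. x \<in> e}"
  then have e: "e \<in> edges G" "x \<in> e" "card e = 2"
    using assms by (auto simp: simple_graph_def)
  then obtain y where "e = {x, y}"
    by (auto simp: card_2_iff)
  then show "e \<in> (\<lambda>y. {x, y}) ` nbrs G x"
    using e by (auto simp: nbrs_def)
qed (auto simp: nbrs_def)

lemma inj_on_doubleton: "inj_on (\<lambda>y. {x, y}) A"
  by (auto simp: inj_on_def doubleton_eq_iff)

lemma card_nbrs:
  assumes "simple_graph G"
  shows "card (nbrs G x) = vertex_degree G x"
  by (simp add: vertex_degree_def incident_edges[OF assms] card_image[OF inj_on_doubleton])

text \<open>As long as \<open>P\<close> is not all of \<open>verts G\<close>, a path from
  \<open>x\<close> to a vertex outside \<open>P\<close> leaves \<open>P\<close> along some edge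
  \<open>{y, z}\<close>, and \<open>z\<close> can be added.\<close>

lemma connected_graph_induct:
  assumes G: "simple_graph G" "connected_graph G" and x: "x \<in> verts G"
    and base: "Q {x}"
    and step: "\<And>P y z. P \<subseteq> verts G \<Longrightarrow> x \<in> P \<Longrightarrow> y \<in> P \<Longrightarrow> z \<in> verts G \<Longrightarrow> z \<notin> P \<Longrightarrow>
                 {y, z} \<in> edges G \<Longrightarrow> Q P \<Longrightarrow> Q (insert z P)"
  shows "Q (verts G)"
proof -
  have fin: "finite (verts G)" using G by (simp add: simple_graph_def)
  have *: "\<exists>P. P \<subseteq> verts G \<and> x \<in> P \<and> Q P \<and> card P = Suc k" if "k < card (verts G)" for k
    using that
  proof (induction k)
    case 0
    then show ?case using x base by (intro exI[of _ "{x}"]) auto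
  next
    case (Suc k)
    then obtain P where P: "P \<subseteq> verts G" "x \<in> P" "Q P" "card P = Suc k" by auto
    have "\<not> verts G \<subseteq> P" using P Suc.prems by (metis less_irrefl subset_antisym)
    then obtain w where w: "w \<in> verts G" "w \<notin> P" by blast
    have "(x, w) \<in> {(x, y). {x, y} \<in> edges G}\<^sup>*"
      using G(2) x w by (auto simp: connected_graph_def)
    then have "w \<notin> P \<longrightarrow> (\<exists>y z. y \<in> P \<and> z \<notin> P \<and> {y, z} \<in> edges G)"
      by (induction rule: rtrancl_induct) (use P in auto)
    then obtain y z where yz: "y \<in> P" "z \<notin> P" "{y, z} \<in> edges G" using w by blast
    then have "z \<in> verts G" using G by (auto dest: edge_in_verts)
    moreover have "card (insert z P) = Suc (Suc k)"
      using P yz finite_subset[OF P(1) fin] by simp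
    ultimately show ?case using P yz step[of P y z] by (intro exI[of _ "insert z P"]) auto
  qed
  have "card (verts G) > 0" using x fin by (auto simp: card_gt_0_iff)
  then obtain P where "P \<subseteq> verts G" "Q P" "card P = card (verts G)"
    using *[of "card (verts G) - 1"] by auto
  then show ?thesis using card_subset_eq[OF fin] by metis
qed

text \<open>A vertex attached to a connected set by two edges would close a cycle, so each step of
  the growth adds exactly one edge.\<close>

lemma tree_card_edges:
  assumes "is_tree F"
  shows "Suc (card (edges F)) = card (verts F)"
proof -
  \<comment> \<open>Besides the edge count, the invariant keeps a path inside \<open>P\<close>
    between any two vertices of \<open>P\<close>; these paths supply the cycles to be
    excluded.\<close>
  let ?path = "\<lambda>P a b ps. ps \<noteq> [] \<and> distinct ps \<and> set ps \<subseteq> P \<and> hd ps = a \<and> last ps = b \<and>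
                 successively (\<lambda>u v. {u, v} \<in> edges F) ps"
  let ?Q = "\<lambda>P. (\<forall>a\<in>P. \<forall>b\<in>P. \<exists>ps. ?path P a b ps) \<and> Suc (card {e \<in> edges F. e \<subseteq> P}) = card P"
  have F: "simple_graph F" "connected_graph F" and acyc: "\<And>xs. \<not> is_cycle F xs"
    using assms by (auto simp: is_tree_def)
  have fin: "finite (verts F)" using F by (simp add: simple_graph_def)
  obtain x where x: "x \<in> verts F" using F(2) by (auto simp: connected_graph_def)
  have "?Q (verts F)"
  proof (rule connected_graph_induct[OF F x])
    have "{e \<in> edges F. e \<subseteq> {x}} = {}"
      using F(1) by (auto simp: simple_graph_def subset_singleton_iff)
    moreover have "?path {x} x x [x]" by simp
    ultimately show "?Q {x}" by (metis (no_types, lifting) card.empty card_1_singleton_iff singletonD)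
  next
    fix P y z
    assume P: "P \<subseteq> verts F" "x \<in> P" "y \<in> P" "z \<in> verts F" "z \<notin> P" "{y, z} \<in> edges F" and IH: "?Q P"
    have finP: "finite P" using P(1) fin finite_subset by blast
    have unique: "y' = y" if y': "y' \<in> P" "{y', z} \<in> edges F" for y'
    proof (rule ccontr)
      assume ne: "y' \<noteq> y"
      obtain ps where ps: "?path P y y' ps" using IH P(3) y' by blast
      have len: "length ps \<ge> 2"
        using ps ne by (cases ps; cases "tl ps") auto
      have edge: "{ps ! i, ps ! Suc i} \<in> edges F" if "Suc i < length ps" for i
        using ps that by (simp add: successively_conv_nth)
      \<comment> \<open>The path from \<open>y\<close> to \<open>y'\<close> is closed into a cycle
        through \<open>z\<close>. Its indices are shifted by one because \<open>z\<close> comes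
        first.\<close>
      have "is_cycle F (z # ps)"
        unfolding is_cycle_def
      proof (intro conjI allI impI)
        fix i assume i: "i < length (z # ps)"
        show "{(z # ps) ! i, (z # ps) ! (Suc i mod length (z # ps))} \<in> edges F"
        proof (cases i)
          case 0
          then show ?thesis using ps len P(6) by (auto simp: hd_conv_nth insert_commute)
        next
          case (Suc k)
          show ?thesis
          proof (cases "Suc k < length ps")
            case True
            then show ?thesis using Suc edge[of k] by simp
          next
            case False
            then have "k = length ps - 1" using i Suc by simp
            then have "ps ! k = y'" using ps last_conv_nth[of ps] by simp
            moreover have "length ps = i" using \<open>k = length ps - 1\<close> Suc len by simp
            ultimately show ?thesis using Suc y'(2) by simp
          qed
        qed
      qed (use len ps P(5) in auto)
      then show False using acyc by blast
    qed
    have "{e \<in> edges F. e \<subseteq> insert z P} = insert {y, z} {e \<in> edges F. e \<subseteq> P}"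
    proof (intro equalityI subsetI)
      fix e assume e: "e \<in> {e \<in> edges F. e \<subseteq> insert z P}"
      show "e \<in> insert {y, z} {e \<in> edges F. e \<subseteq> P}"
      proof (cases "z \<in> e")
        case True
        then obtain y' where "e = {z, y'}" "y' \<in> nbrs F z"
          using e incident_edges[OF F(1), of z] by blast
        then show ?thesis using e unique[of y'] edge_in_verts[OF F(1), of z y']
          by (auto simp: insert_commute)
      qed (use e in auto)
    qed (use P in auto)
    moreover have "{y, z} \<notin> {e \<in> edges F. e \<subseteq> P}" using P by auto
    moreover have "finite {e \<in> edges F. e \<subseteq> P}" using finite_edges[OF F(1)] by simp
    ultimately have "Suc (card {e \<in> edges F. e \<subseteq> insert z P}) = card (insert z P)"
      using IH finP P(5) by simp
    moreover have "\<exists>ps. ?path (insert z P) a b ps" if ab: "a \<in> insert z P" "b \<in> insert z P" for a b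
    proof -
      consider "a = z" "b = z" | "a \<in> P" "b \<in> P" | "a \<in> P" "b = z" | "a = z" "b \<in> P"
        using ab by blast
      then show ?thesis
      proof cases
        case 1
        then show ?thesis by (intro exI[of _ "[z]"]) auto
      next
        case 2
        then obtain ps where "?path P a b ps" using IH by blast
        then show ?thesis by (intro exI[of _ ps]) auto
      next
        case 3
        then obtain ps where "?path P a y ps" using IH P(3) by blast
        then show ?thesis using 3 P
          by (intro exI[of _ "ps @ [z]"]) (auto simp: successively_append_iff)
      next
        case 4
        then obtain ps where "?path P y b ps" using IH P(3) by blast
        then show ?thesis using 4 P
          by (intro exI[of _ "z # ps"]) (auto simp: successively_Cons insert_commute)
      qed
    qed
    ultimately show "?Q (insert z P)" by blast
  qed
  moreover have "{e \<in> edges F. e \<subseteq> verts F} = edges F" using F(1) by (auto simp: simple_graph_def)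
  ultimately show ?thesis by simp
qed

section \<open>Copies counted through embeddings\<close>

definition embeddings :: "'a ugraph \<Rightarrow> 'b ugraph \<Rightarrow> ('a \<Rightarrow> 'b) set" where
  "embeddings F G = {\<phi> \<in> verts F \<rightarrow>\<^sub>E verts G. inj_on \<phi> (verts F) \<and> (\<forall>e\<in>edges F. \<phi> ` e \<in> edges G)}"

text \<open>Extensionality makes an isomorphism determined by its values on \<open>verts F\<close>,
  so that isomorphisms can be counted; \<open>isos F F\<close> is the automorphism group of
  \<open>F\<close>.\<close>

definition isos :: "'a ugraph \<Rightarrow> 'b ugraph \<Rightarrow> ('a \<Rightarrow> 'b) set" where
  "isos F C = {\<phi> \<in> extensional (verts F). bij_betw \<phi> (verts F) (verts C) \<and> edges C = (`) \<phi> ` edges F}"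

lemma finite_embeddings:
  assumes "simple_graph F" "simple_graph G"
  shows "finite (embeddings F G)"
  by (rule finite_subset[of _ "verts F \<rightarrow>\<^sub>E verts G"])
    (use assms in \<open>auto simp: embeddings_def simple_graph_def intro!: finite_PiE\<close>)

lemma isomorphic_sym:
  assumes "simple_graph G" "isomorphic G H"
  shows "isomorphic H G"
proof -
  obtain f where f: "bij_betw f (verts G) (verts H)" "edges H = (`) f ` edges G"
    using assms(2) by (auto simp: isomorphic_def)
  let ?g = "the_inv_into (verts G) f"
  have "?g ` (f ` e) = e" if "e \<in> edges G" for e
    using that f(1) assms(1)
    by (force simp: bij_betw_def simple_graph_def image_image the_inv_into_f_f subset_iff)
  then have "edges G = (`) ?g ` edges H"
    by (auto simp: f(2) image_image)
  then show ?thesis using bij_betw_the_inv_into[OF f(1)] by (auto simp: isomorphic_def)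
qed

text \<open>Composition with \<open>g\<close> turns automorphisms of \<open>F\<close> into
  isomorphisms onto \<open>C\<close>, and composition with the inverse of \<open>g\<close> undoes
  this. So the number is the same for every copy.\<close>

lemma card_isos:
  assumes F: "simple_graph F" and "g \<in> isos F C"
  shows "card (isos F C) = card (isos F F)"
proof -
  let ?V = "verts F"
  let ?h = "the_inv_into ?V g"
  have g: "bij_betw g ?V (verts C)" "edges C = (`) g ` edges F"
    using assms(2) by (auto simp: isos_def)
  have sub: "e \<subseteq> ?V" if "e \<in> edges F" for e using that F by (auto simp: simple_graph_def)
  have h: "bij_betw ?h (verts C) ?V" by (rule bij_betw_the_inv_into[OF g(1)])
  have gh: "g (?h y) = y" if "y \<in> verts C" for y
    using that g(1) f_the_inv_into_f_bij_betw by metis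
  have hg: "?h (g x) = x" if "x \<in> ?V" for x
    using that g(1) by (simp add: bij_betw_def the_inv_into_f_f)
  have im: "(restrict f ?V) ` e = f ` e" if "e \<in> edges F" for f and e :: "'a set"
    using sub[OF that] by (auto simp: subset_iff)
  have hge: "?h ` (g ` e) = e" if "e \<in> edges F" for e
    using sub[OF that] hg by (force simp: image_image subset_iff)
  have "bij_betw (\<lambda>\<sigma>. restrict (g \<circ> \<sigma>) ?V) (isos F F) (isos F C)"
  proof (rule bij_betw_byWitness[where f' = "\<lambda>\<phi>. restrict (?h \<circ> \<phi>) ?V"])
    show "\<forall>\<sigma>\<in>isos F F. restrict (?h \<circ> restrict (g \<circ> \<sigma>) ?V) ?V = \<sigma>"
      using hg by (auto simp: isos_def extensional_def bij_betw_def fun_eq_iff restrict_def)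
    show "\<forall>\<phi>\<in>isos F C. restrict (g \<circ> restrict (?h \<circ> \<phi>) ?V) ?V = \<phi>"
      using gh by (auto simp: isos_def extensional_def bij_betw_def fun_eq_iff restrict_def)
    show "(\<lambda>\<sigma>. restrict (g \<circ> \<sigma>) ?V) ` isos F F \<subseteq> isos F C"
    proof (safe)
      fix \<sigma> assume s: "\<sigma> \<in> isos F F"
      have "bij_betw (g \<circ> \<sigma>) ?V (verts C)" using s g(1) by (auto simp: isos_def intro: bij_betw_trans)
      moreover
      have "(`) (restrict (g \<circ> \<sigma>) ?V) ` edges F = (`) (g \<circ> \<sigma>) ` edges F"
        by (intro image_cong refl im)
      then have "(`) (restrict (g \<circ> \<sigma>) ?V) ` edges F = (`) g ` ((`) \<sigma> ` edges F)"
        by (simp add: image_image o_def)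
      ultimately show "restrict (g \<circ> \<sigma>) ?V \<in> isos F C"
        using s g(2) by (auto simp: isos_def cong: bij_betw_cong)
    qed
    show "(\<lambda>\<phi>. restrict (?h \<circ> \<phi>) ?V) ` isos F C \<subseteq> isos F F"
    proof (safe)
      fix \<phi> assume s: "\<phi> \<in> isos F C"
      have "bij_betw (?h \<circ> \<phi>) ?V ?V" using s h by (auto simp: isos_def intro: bij_betw_trans)
      moreover
      have "(`) (restrict (?h \<circ> \<phi>) ?V) ` edges F = (`) (?h \<circ> \<phi>) ` edges F"
        by (intro image_cong refl im)
      then have "(`) (restrict (?h \<circ> \<phi>) ?V) ` edges F = (`) ?h ` ((`) \<phi> ` edges F)"
        by (simp add: image_image o_def)
      moreover have "(`) \<phi> ` edges F = (`) g ` edges F" using s g(2) by (auto simp: isos_def)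
      moreover have "(`) ?h ` ((`) g ` edges F) = edges F"
        using hge by (force simp: image_image)
      ultimately show "restrict (?h \<circ> \<phi>) ?V \<in> isos F F"
        using s by (auto simp: isos_def cong: bij_betw_cong)
    qed
  qed
  then show ?thesis by (metis bij_betw_same_card)
qed

text \<open>An embedding has exactly one copy as its image, and the embeddings with image
  \<open>C\<close> are \<open>isos F C\<close>. The common factor \<open>card (isos F F)\<close>
  cancels when copies in \<open>H\<close> and in the complete graph are compared.\<close>

lemma card_embeddings:
  assumes F: "simple_graph F" and G: "simple_graph G"
  shows "card (embeddings F G) = num_copies G F * card (isos F F)"
proof -
  have iso: "\<exists>g. g \<in> isos F C" if "C \<in> copies G F" for C
  proof -
    have "isomorphic F C" using that by (auto simp: copies_def subgraph_def intro: isomorphic_sym)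
    then obtain g where g: "bij_betw g (verts F) (verts C)" "edges C = (`) g ` edges F"
      by (auto simp: isomorphic_def)
    have "(`) (restrict g (verts F)) ` edges F = (`) g ` edges F"
      using F by (intro image_cong) (auto simp: simple_graph_def subset_iff)
    then have "restrict g (verts F) \<in> isos F C" using g by (auto simp: isos_def cong: bij_betw_cong)
    then show ?thesis by blast
  qed
  have "embeddings F G = (\<Union>C\<in>copies G F. isos F C)"
  proof (intro equalityI subsetI)
    fix \<phi> assume p: "\<phi> \<in> embeddings F G"
    let ?C = "Graph (\<phi> ` verts F) ((`) \<phi> ` edges F)"
    have "card (\<phi> ` e) = 2" if "e \<in> edges F" for e
      using that F p card_image[of \<phi> e] inj_on_subset[of \<phi> "verts F" e]
      by (auto simp: simple_graph_def embeddings_def)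
    moreover have "\<phi> ` e \<subseteq> \<phi> ` verts F" if "e \<in> edges F" for e
      using that F by (auto simp: simple_graph_def)
    moreover have "\<phi> ` verts F \<subseteq> verts G" using p by (auto simp: embeddings_def)
    ultimately have "subgraph ?C G"
      using F G p by (auto simp: subgraph_def simple_graph_def embeddings_def)
    moreover have iso: "\<phi> \<in> isos F ?C"
      using p by (auto simp: isos_def embeddings_def bij_betw_def PiE_def)
    then have "isomorphic F ?C" by (auto simp: isos_def isomorphic_def)
    then have "isomorphic ?C F" using F by (rule isomorphic_sym[rotated])
    ultimately show "\<phi> \<in> (\<Union>C\<in>copies G F. isos F C)" using iso by (auto simp: copies_def)
  next
    fix \<phi> assume "\<phi> \<in> (\<Union>C\<in>copies G F. isos F C)"
    then show "\<phi> \<in> embeddings F G"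
      by (fastforce simp: copies_def isos_def embeddings_def subgraph_def bij_betw_def PiE_def)
  qed
  moreover have "isos F C \<inter> isos F C' = {}" if "C \<noteq> C'" for C C' :: "'b ugraph"
  proof -
    have "C = C'" if "\<phi> \<in> isos F C" "\<phi> \<in> isos F C'" for \<phi>
      using that by (intro ugraph.expand) (auto simp: isos_def bij_betw_def)
    then show ?thesis using that by blast
  qed
  moreover have "finite (isos F C)" if "C \<in> copies G F" for C
    using finite_subset[of "isos F C" "embeddings F G"] finite_embeddings[OF F G] that calculation(1)
    by blast
  ultimately have "card (embeddings F G) = (\<Sum>C\<in>copies G F. card (isos F C))"
    using finite_copies[OF G, of F] by (simp add: card_UN_disjoint)
  also have "\<dots> = (\<Sum>C\<in>copies G F. card (isos F F))"
    using iso card_isos[OF F] by (intro sum.cong) blast+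
  finally show ?thesis by (simp add: num_copies_def)
qed

subsection \<open>Growing a tree in a host graph\<close>

text \<open>Weighting an embedding by \<open>exp (- \<Sum>x. deg x * \<mu> (\<phi> x))\<close> compensates for
  the number of ways to continue it from a vertex of large degree.\<close>

lemma sum_weighted_embeddings_le:
  fixes \<mu> :: "'b \<Rightarrow> real"
  assumes F: "simple_graph F" "connected_graph F" and H: "simple_graph H" and x0: "x0 \<in> verts F"
    and \<mu>: "\<And>y. y \<in> verts H \<Longrightarrow> 0 \<le> \<mu> y"
    and deg: "\<And>y. y \<in> verts H \<Longrightarrow> real (card (nbrs H y)) \<le> c * exp (\<mu> y)"
    and c: "0 \<le> c"
  shows "(\<Sum>\<phi> | \<phi> \<in> embeddings F H \<and> \<phi> x0 = u.
            exp (- (\<Sum>x\<in>verts F. real (vertex_degree F x) * \<mu> (\<phi> x)))) \<le> c ^ (card (verts F) - 1)"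
proof -
  let ?E = "\<lambda>P. {\<phi> \<in> embeddings (induced F P) H. \<phi> x0 = u}"
  let ?d = "\<lambda>P x. real (vertex_degree (induced F P) x)"
  let ?w = "\<lambda>P \<phi>. exp (- (\<Sum>x\<in>P. ?d P x * \<mu> (\<phi> x)))"
  have fin: "finite (verts F)" using F by (simp add: simple_graph_def)
  have simp_ind: "simple_graph (induced F P)" if "P \<subseteq> verts F" for P
    using that F(1) finite_subset by (auto simp: simple_graph_def)
  have "(\<Sum>\<phi>\<in>?E (verts F). ?w (verts F) \<phi>) \<le> c ^ (card (verts F) - 1)"
  proof (rule connected_graph_induct[OF F x0, where Q = "\<lambda>P. (\<Sum>\<phi>\<in>?E P. ?w P \<phi>) \<le> c ^ (card P - 1)"])
    have sub: "?E {x0} \<subseteq> {restrict (\<lambda>_. u) {x0}}"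
      by (auto simp: embeddings_def PiE_def extensional_def fun_eq_iff)
    have "?w {x0} \<phi> \<le> 1" if "\<phi> \<in> ?E {x0}" for \<phi>
      using that \<mu>[of "\<phi> x0"] by (auto simp: embeddings_def intro!: mult_nonneg_nonneg)
    then have "(\<Sum>\<phi>\<in>?E {x0}. ?w {x0} \<phi>) \<le> (\<Sum>\<phi>\<in>?E {x0}. 1)" by (rule sum_mono)
    also have "\<dots> \<le> 1" using card_mono[OF _ sub] by simp
    finally show "(\<Sum>\<phi>\<in>?E {x0}. ?w {x0} \<phi>) \<le> c ^ (card {x0} - 1)" by simp
  next
    fix P y z
    assume P: "P \<subseteq> verts F" "x0 \<in> P" "y \<in> P" "z \<in> verts F" "z \<notin> P" "{y, z} \<in> edges F"
      and IH: "(\<Sum>\<phi>\<in>?E P. ?w P \<phi>) \<le> c ^ (card P - 1)"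
    let ?P = "insert z P"
    have finP: "finite P" using P(1) fin finite_subset by blast
    have fe: "finite {e \<in> edges F. e \<subseteq> ?P \<and> x \<in> e}" for x using finite_edges[OF F(1)] by simp
    have degP: "?d P x \<le> ?d ?P x" for x
      using fe[of x] by (auto simp: vertex_degree_def intro!: card_mono intro: finite_subset)
    \<comment> \<open>The edge \<open>{y, z}\<close> raises the degree of \<open>y\<close>, so the
      weight of an extension gains a factor \<open>exp (- \<mu> (\<phi> y))\<close>. It absorbs the
      excess over \<open>c\<close> in the number of choices for the image of
      \<open>z\<close>.\<close>
    have degy: "?d P y + 1 \<le> ?d ?P y"
    proof -
      have "{e \<in> edges F. e \<subseteq> P \<and> y \<in> e} \<subset> {e \<in> edges F. e \<subseteq> ?P \<and> y \<in> e}"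
        (is "?A \<subset> ?B")
      proof
        have "{y, z} \<in> ?B" "{y, z} \<notin> ?A" using P by auto
        then show "?A \<noteq> ?B" by metis
      qed auto
      then have "card {e \<in> edges F. e \<subseteq> P \<and> y \<in> e} < card {e \<in> edges F. e \<subseteq> ?P \<and> y \<in> e}"
        by (rule psubset_card_mono[OF fe])
      then show ?thesis by (simp add: vertex_degree_def)
    qed
    \<comment> \<open>An embedding of the grown set is determined by its restriction to
      \<open>P\<close> and by the image of \<open>z\<close>, a neighbour of the image of
      \<open>y\<close>.\<close>
    let ?r = "\<lambda>\<phi>. (restrict \<phi> P, \<phi> z)"
    let ?S = "Sigma (?E P) (\<lambda>\<phi>. nbrs H (\<phi> y))"
    have finE: "finite (?E P)" using finite_embeddings[OF simp_ind[OF P(1)] H] by simp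
    have inj: "inj_on ?r (?E ?P)"
    proof (rule inj_onI)
      fix \<phi> \<psi> assume "\<phi> \<in> ?E ?P" "\<psi> \<in> ?E ?P" and eq: "?r \<phi> = ?r \<psi>"
      then have ext: "\<phi> \<in> extensional ?P" "\<psi> \<in> extensional ?P"
        by (simp_all add: embeddings_def PiE_def)
      show "\<phi> = \<psi>"
      proof (rule extensionalityI[OF ext])
        fix x assume "x \<in> ?P"
        then show "\<phi> x = \<psi> x" using eq by (cases "x = z") (auto dest: fun_cong[of _ _ x])
      qed
    qed
    have img: "?r ` ?E ?P \<subseteq> ?S"
    proof (rule image_subsetI)
      fix \<phi> assume p: "\<phi> \<in> ?E ?P"
      have "restrict \<phi> P ` e = \<phi> ` e" if "e \<subseteq> P" for e using that by auto
      then have "restrict \<phi> P \<in> embeddings (induced F P) H"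
        using p by (auto simp: embeddings_def inj_on_def)
      moreover have "\<phi> ` {y, z} \<in> edges H" using p P by (auto simp: embeddings_def simp del: image_insert)
      then have "\<phi> z \<in> nbrs H (restrict \<phi> P y)" using P by (simp add: nbrs_def)
      ultimately show "?r \<phi> \<in> ?S" using p P by simp
    qed
    have wle: "?w ?P \<phi> \<le> ?w P (restrict \<phi> P) * exp (- \<mu> (\<phi> y))" if "\<phi> \<in> ?E ?P" for \<phi>
    proof -
      have nn: "0 \<le> \<mu> (\<phi> x)" if "x \<in> ?P" for x
        using that \<open>\<phi> \<in> ?E ?P\<close> by (intro \<mu>) (auto simp: embeddings_def)
      have "(\<Sum>x\<in>P. ?d P x * \<mu> (\<phi> x)) + \<mu> (\<phi> y) = (\<Sum>x\<in>P. (?d P x + (if x = y then 1 else 0)) * \<mu> (\<phi> x))"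
        using finP P(3) by (simp add: distrib_right sum.distrib if_distrib[of "\<lambda>a. a * _"] cong: if_cong)
      also have "\<dots> \<le> (\<Sum>x\<in>P. ?d ?P x * \<mu> (\<phi> x))"
        using degP degy nn by (intro sum_mono mult_right_mono) auto
      also have "\<dots> \<le> (\<Sum>x\<in>?P. ?d ?P x * \<mu> (\<phi> x))"
        using nn finP P(5) by simp
      finally show ?thesis by (simp flip: exp_add)
    qed
    have "(\<Sum>\<phi>\<in>?E ?P. ?w ?P \<phi>) \<le> (\<Sum>\<phi>\<in>?E ?P. ?w P (restrict \<phi> P) * exp (- \<mu> (\<phi> y)))"
      using wle by (rule sum_mono)
    also have "\<dots> = (\<Sum>(\<psi>, a)\<in>?r ` ?E ?P. ?w P \<psi> * exp (- \<mu> (\<psi> y)))"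
      using P(3) by (subst sum.reindex[OF inj]) (simp add: o_def)
    also have "\<dots> \<le> (\<Sum>(\<psi>, a)\<in>?S. ?w P \<psi> * exp (- \<mu> (\<psi> y)))"
      using finE finite_nbrs[OF H] by (intro sum_mono2 img) auto
    also have "\<dots> = (\<Sum>\<psi>\<in>?E P. ?w P \<psi> * (card (nbrs H (\<psi> y)) * exp (- \<mu> (\<psi> y))))"
      using finE finite_nbrs[OF H] by (subst sum.Sigma[symmetric]) (auto simp: mult_ac)
    also have "\<dots> \<le> (\<Sum>\<psi>\<in>?E P. ?w P \<psi> * c)"
    proof (intro sum_mono mult_left_mono)
      fix \<psi> assume "\<psi> \<in> ?E P"
      then have "\<psi> y \<in> verts H" using P by (auto simp: embeddings_def)
      then show "card (nbrs H (\<psi> y)) * exp (- \<mu> (\<psi> y)) \<le> c"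
        using deg[of "\<psi> y"] by (simp add: exp_minus field_simps)
    qed auto
    also have "\<dots> \<le> c ^ (card P - 1) * c"
      using IH c by (simp flip: sum_distrib_right add: mult_right_mono)
    also have "\<dots> = c ^ (card ?P - 1)"
    proof -
      have "card P > 0" using finP P(2) by (auto simp: card_gt_0_iff)
      then show ?thesis using finP P(5) by (cases "card P") auto
    qed
    finally show "(\<Sum>\<phi>\<in>?E ?P. ?w ?P \<phi>) \<le> c ^ (card ?P - 1)" .
  qed
  then show ?thesis by (simp add: induced_verts[OF F(1)])
qed

text \<open>A Markov-type bound: since no degree exceeds \<open>\<Delta>\<close>, an embedding
  counted here has weight at least \<open>exp (- (real \<Delta> * b))\<close> in
  \<open>sum_weighted_embeddings_le\<close>.\<close>

lemma card_rooted_embeddings_le: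
  fixes \<mu> :: "'b \<Rightarrow> real"
  assumes F: "simple_graph F" "connected_graph F" and H: "simple_graph H" and x0: "x0 \<in> verts F"
    and \<Delta>: "\<And>x. x \<in> verts F \<Longrightarrow> vertex_degree F x \<le> \<Delta>"
    and \<mu>: "\<And>y. y \<in> verts H \<Longrightarrow> 0 \<le> \<mu> y"
    and deg: "\<And>y. y \<in> verts H \<Longrightarrow> real (card (nbrs H y)) \<le> c * exp (\<mu> y)"
    and c: "0 \<le> c"
  shows "real (card {\<phi> \<in> embeddings F H. \<phi> x0 = u \<and> (\<Sum>x\<in>verts F. \<mu> (\<phi> x)) \<le> b}) \<le>
           c ^ (card (verts F) - 1) * exp (real \<Delta> * b)"
proof -
  let ?w = "\<lambda>\<phi>. exp (- (\<Sum>x\<in>verts F. real (vertex_degree F x) * \<mu> (\<phi> x)))"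
  let ?A = "{\<phi> \<in> embeddings F H. \<phi> x0 = u \<and> (\<Sum>x\<in>verts F. \<mu> (\<phi> x)) \<le> b}"
  have fin: "finite (embeddings F H)" by (rule finite_embeddings[OF F(1) H])
  have "exp (- (real \<Delta> * b)) \<le> ?w \<phi>" if "\<phi> \<in> ?A" for \<phi>
  proof -
    have nn: "0 \<le> \<mu> (\<phi> x)" if "x \<in> verts F" for x
      using that \<open>\<phi> \<in> ?A\<close> by (intro \<mu>) (auto simp: embeddings_def)
    have "(\<Sum>x\<in>verts F. real (vertex_degree F x) * \<mu> (\<phi> x)) \<le> (\<Sum>x\<in>verts F. real \<Delta> * \<mu> (\<phi> x))"
      using \<Delta> nn by (intro sum_mono mult_right_mono) auto
    also have "\<dots> \<le> real \<Delta> * b" using that by (auto simp flip: sum_distrib_left intro: mult_left_mono)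
    finally show ?thesis by simp
  qed
  then have "(\<Sum>\<phi>\<in>?A. exp (- (real \<Delta> * b))) \<le> (\<Sum>\<phi>\<in>?A. ?w \<phi>)" by (rule sum_mono)
  also have "\<dots> \<le> (\<Sum>\<phi> | \<phi> \<in> embeddings F H \<and> \<phi> x0 = u. ?w \<phi>)"
    using fin by (intro sum_mono2) auto
  also have "\<dots> \<le> c ^ (card (verts F) - 1)"
    by (rule sum_weighted_embeddings_le[OF F H x0 \<mu> deg c])
  finally show ?thesis by (simp add: exp_minus field_simps)
qed

section \<open>Embeddings into the complete graph\<close>

lemma fact_ge_power_exp: "real k ^ k \<le> exp (real k) * fact k"
proof -
  have "(\<Sum>i\<in>{k}. real k ^ i /\<^sub>R fact i) \<le> (\<Sum>i. real k ^ i /\<^sub>R fact i)"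
    using summable_exp_generic[of "real k"] by (intro sum_le_suminf) auto
  then show ?thesis by (simp add: exp_def divide_simps)
qed

text \<open>Every injection is an embedding, so with \<open>v = card (verts F)\<close> the count is
  the falling factorial \<open>(n choose v) * fact v\<close>. Here \<open>n choose v\<close> is at
  least \<open>(n / v) ^ v\<close>, and \<open>fact v\<close> is at least
  \<open>v ^ v / exp v\<close>, as \<open>v ^ v / fact v\<close> is a term of the series of
  \<open>exp v\<close>.\<close>

lemma card_embeddings_complete_ge:
  assumes F: "simple_graph F" and le: "card (verts F) \<le> n"
  shows "real n ^ card (verts F) \<le> exp (card (verts F)) * card (embeddings F (complete_ugraph n))"
proof -
  let ?v = "card (verts F)"
  have fin: "finite (verts F)" using F by (simp add: simple_graph_def)
  have "embeddings F (complete_ugraph n) = {\<phi> \<in> verts F \<rightarrow>\<^sub>E {..<n}. inj_on \<phi> (verts F)}"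
  proof -
    have "\<phi> ` e \<subseteq> {..<n} \<and> card (\<phi> ` e) = 2"
      if "\<phi> \<in> verts F \<rightarrow>\<^sub>E {..<n}" "inj_on \<phi> (verts F)" "e \<in> edges F" for \<phi> e
      using that F card_image[of \<phi> e] inj_on_subset[of \<phi> "verts F" e]
      by (fastforce simp: simple_graph_def)
    then show ?thesis by (auto simp: embeddings_def complete_ugraph_def)
  qed
  then have card: "card (embeddings F (complete_ugraph n)) = (\<Prod>i<?v. n - i)"
    using card_inj_on_subset_funcset[OF fin, of "{..<n}" "verts F"] by (simp add: lessThan_atLeast0)
  have pr: "(\<Prod>i<k. n - i) = (n choose k) * fact k" for k
  proof (induction k)
    case (Suc k)
    have eq: "(n choose Suc k) * Suc k = (n choose k) * (n - k)"
      using binomial_absorption[of k n] binomial_absorb_comp[of n k] by (simp add: mult.commute)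
    have "(\<Prod>i<Suc k. n - i) = fact k * ((n choose k) * (n - k))" using Suc by (simp add: mult_ac)
    also have "\<dots> = fact k * ((n choose Suc k) * Suc k)" by (simp only: eq)
    finally show ?case by (simp add: algebra_simps)
  qed simp
  have "real n ^ ?v \<le> real (n choose ?v) * real ?v ^ ?v"
  proof (cases "?v = 0")
    case False
    then show ?thesis
      using binomial_ge_n_over_k_pow_k[OF le, where 'a = real] by (simp add: power_divide divide_simps)
  qed simp
  also have "\<dots> \<le> real (n choose ?v) * (exp ?v * fact ?v)"
    by (intro mult_left_mono fact_ge_power_exp) auto
  finally show ?thesis by (simp add: card pr mult_ac)
qed

subsection \<open>Disjoint embeddings with stars\<close>

lemma prod_one_plus:
  fixes f :: "'a \<Rightarrow> real"
  assumes "finite A"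
  shows "(\<Prod>a\<in>A. 1 + f a) = (\<Sum>X\<in>Pow A. \<Prod>a\<in>X. f a)"
  using prod_add[OF assms, of f "\<lambda>_. 1"] by (simp add: add.commute)

text \<open>Exponential tilting: each of the \<open>m\<close> factors is multiplied by
  \<open>exp 1\<close>, and the sum is enlarged to all subsets. There it factors into terms
  \<open>1 + exp 1 * w a\<close>, each at most \<open>exp (exp 1 * w a)\<close>.\<close>

lemma sum_prod_subsets_le:
  fixes w :: "'a \<Rightarrow> real"
  assumes fin: "finite A" and w: "\<And>a. a \<in> A \<Longrightarrow> 0 \<le> w a"
    and S: "\<S> \<subseteq> Pow A" "\<And>X. X \<in> \<S> \<Longrightarrow> card X = m"
  shows "(\<Sum>X\<in>\<S>. \<Prod>a\<in>X. w a) \<le> exp (exp 1 * (\<Sum>a\<in>A. w a) - m)"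
proof -
  have "exp (real m) * (\<Sum>X\<in>\<S>. prod w X) = (\<Sum>X\<in>\<S>. \<Prod>a\<in>X. exp 1 * w a)"
    unfolding sum_distrib_left
    by (intro sum.cong) (auto simp: prod.distrib S(2) simp flip: exp_of_nat_mult)
  also have "\<dots> \<le> (\<Sum>X\<in>Pow A. \<Prod>a\<in>X. exp 1 * w a)"
    using fin S(1) w by (intro sum_mono2) (auto intro!: prod_nonneg)
  also have "\<dots> = (\<Prod>a\<in>A. 1 + exp 1 * w a)" by (rule prod_one_plus[OF fin, symmetric])
  also have "\<dots> \<le> (\<Prod>a\<in>A. exp (exp 1 * w a))"
    using w by (intro prod_mono) (auto intro!: add_nonneg_nonneg)
  also have "\<dots> = exp (exp 1 * (\<Sum>a\<in>A. w a))"
    using fin by (simp add: exp_sum sum_distrib_left)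
  finally show ?thesis by (simp add: exp_diff field_simps)
qed

text \<open>In the application \<open>lab y\<close> is the degree of \<open>y\<close> in
  \<open>H\<close> if this exceeds \<open>K * \<Lambda>\<close>, and \<open>0\<close>
  otherwise.\<close>

locale disjoint_embeddings =
  fixes F :: "'a ugraph" and H :: "nat ugraph" and \<M> :: "('a \<Rightarrow> nat) set"
    and lab :: "nat \<Rightarrow> nat" and \<Delta> :: nat
  assumes F: "simple_graph F" and F_nonempty: "verts F \<noteq> {}" and H: "simple_graph H"
    and emb: "\<M> \<subseteq> embeddings F H"
    and disj: "\<And>\<phi> \<psi>. \<phi> \<in> \<M> \<Longrightarrow> \<psi> \<in> \<M> \<Longrightarrow> \<phi> \<noteq> \<psi> \<Longrightarrow> \<phi> ` verts F \<inter> \<psi> ` verts F = {}"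
    and degree: "\<And>x. x \<in> verts F \<Longrightarrow> vertex_degree F x \<le> \<Delta>"
    and lab: "\<And>y. lab y = 0 \<or> lab y = card (nbrs H y)"
begin

definition "centers = (\<Union>\<phi>\<in>\<M>. \<phi> ` verts F)"
definition "tree_edges = (\<Union>\<phi>\<in>\<M>. (`) \<phi> ` edges F)"
definition "free y = {z \<in> nbrs H y. {y, z} \<notin> tree_edges}"
text \<open>A strict total order, with ties between labels broken by the vertex number. Preferring
  the larger label ensures that the winning end of an edge carries a star whenever the losing end
  has a positive label, and that an increasing function of the label does not shrink when the edge
  is moved to its winning end.\<close>

definition "beats y z \<longleftrightarrow> lab z < lab y \<or> lab z = lab y \<and> z < y"

text \<open>An edge joining two centers is assigned to only one of them, the one that \<open>beats\<close> the
  other, so that it is counted once.\<close>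

definition "star y = (if y \<in> centers \<and> lab y > 0 then {z \<in> free y. \<not> (z \<in> centers \<and> beats z y)} else {})"

definition "star_edges = (\<Union>y\<in>centers. (\<lambda>z. {y, z}) ` star y)"
definition "union_graph = Graph (centers \<union> (\<Union>y\<in>centers. star y)) (tree_edges \<union> star_edges)"

lemma fin: "finite (verts F)" "finite \<M>" "finite centers" "finite (edges F)" "finite (nbrs H y)"
  "finite (free y)" "finite (star y)" "finite tree_edges"
proof -
  show "finite (verts F)" "finite (edges F)" using F finite_edges by (auto simp: simple_graph_def)
  moreover show "finite \<M>" using emb finite_embeddings[OF F H] finite_subset by blast
  ultimately show "finite centers" "finite tree_edges" by (auto simp: centers_def tree_edges_def)
  show "finite (nbrs H y)" by (rule finite_nbrs[OF H])
  then show "finite (free y)" by (simp add: free_def)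
  then show "finite (star y)" by (simp add: star_def)
qed

lemma emb_inj: "\<phi> \<in> \<M> \<Longrightarrow> inj_on \<phi> (verts F)"
  using emb by (auto simp: embeddings_def)

lemma edge_sub: "e \<in> edges F \<Longrightarrow> e \<subseteq> verts F" "e \<in> edges F \<Longrightarrow> e \<noteq> {}"
  using F by (auto simp: simple_graph_def)

lemma same_embedding:
  assumes "\<phi> \<in> \<M>" "\<psi> \<in> \<M>" "x \<in> verts F" "x' \<in> verts F" "\<phi> x = \<psi> x'"
  shows "\<phi> = \<psi>" "x = x'"
proof -
  show "\<phi> = \<psi>" using assms disj[of \<phi> \<psi>] by (metis disjoint_iff imageI)
  then show "x = x'" using assms emb_inj[of \<phi>] by (auto dest: inj_onD)
qed

lemma bij_centers: "bij_betw (\<lambda>(\<phi>, x). \<phi> x) (\<M> \<times> verts F) centers"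
  by (auto simp: bij_betw_def inj_on_def centers_def image_iff dest: same_embedding)

lemma bij_tree_edges: "bij_betw (\<lambda>(\<phi>, e). \<phi> ` e) (\<M> \<times> edges F) tree_edges"
proof -
  have "\<phi> = \<psi> \<and> e = e'"
    if *: "\<phi> \<in> \<M>" "\<psi> \<in> \<M>" "e \<in> edges F" "e' \<in> edges F" "\<phi> ` e = \<psi> ` e'" for \<phi> \<psi> e e'
  proof -
    obtain x where x: "x \<in> e" using edge_sub[OF *(3)] by blast
    then obtain x' where x': "x' \<in> e'" "\<phi> x = \<psi> x'" using *(5) by blast
    have eq: "\<phi> = \<psi>" using same_embedding[OF *(1,2), of x x'] x x' edge_sub * by blast
    then show ?thesis using inj_on_image_eq_iff[OF emb_inj[OF *(1)]] edge_sub * by blast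
  qed
  then show ?thesis by (auto simp: bij_betw_def inj_on_def tree_edges_def image_iff)
qed

lemma prod_centers: "(\<Prod>y\<in>centers. k y) = (\<Prod>\<phi>\<in>\<M>. \<Prod>x\<in>verts F. k (\<phi> x))"
  for k :: "nat \<Rightarrow> real"
  using prod.reindex_bij_betw[OF bij_centers, of k]
  by (simp add: prod.cartesian_product split_def)

lemma centers_sub: "centers \<subseteq> verts H"
  using emb by (auto simp: centers_def embeddings_def)

lemma tree_edges_sub: "tree_edges \<subseteq> edges H"
  using emb by (auto simp: tree_edges_def embeddings_def)

lemma tree_edges_centers: "e \<in> tree_edges \<Longrightarrow> e \<subseteq> centers"
  using edge_sub by (fastforce simp: tree_edges_def centers_def)

lemma star_sub: "star y \<subseteq> nbrs H y"
  by (auto simp: star_def free_def)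

lemma star_edges_sub: "star_edges \<subseteq> edges H"
  using star_sub by (fastforce simp: star_edges_def nbrs_def)

lemma union_graph_sub: "subgraph union_graph H"
proof -
  have "z \<in> verts H" if "z \<in> star y" for y z
    using that star_sub[of y] edge_in_verts(2)[OF H, of y z] by (auto simp: nbrs_def)
  then have "verts union_graph \<subseteq> verts H"
    using centers_sub by (auto simp: union_graph_def)
  moreover have "edges union_graph \<subseteq> edges H"
    using tree_edges_sub star_edges_sub by (simp add: union_graph_def)
  moreover have "e \<subseteq> verts union_graph" if "e \<in> edges union_graph" for e
    using that tree_edges_centers[of e] by (auto simp: union_graph_def star_edges_def)
  ultimately show ?thesis
    using H finite_subset unfolding subgraph_def simple_graph_def by blast
qed

lemma beats_asym: "beats y z \<Longrightarrow> \<not> beats z y" and beats_total: "y \<noteq> z \<Longrightarrow> beats y z \<or> beats z y"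
  by (auto simp: beats_def)

text \<open>Disjointness makes the tree edges of different embeddings distinct, and an edge lying in
  two stars would join two centers of which neither beats the other.\<close>

lemma card_union_edges:
  "card (edges union_graph) = card \<M> * card (edges F) + (\<Sum>y\<in>centers. card (star y))"
proof -
  have inj: "inj_on (\<lambda>(y, z). {y, z}) (Sigma centers star)"
  proof -
    have "y = y' \<and> z = z'"
      if "y \<in> centers" "z \<in> star y" "y' \<in> centers" "z' \<in> star y'" "{y, z} = {y', z'}" for y z y' z'
    proof (rule ccontr)
      assume "\<not> (y = y' \<and> z = z')"
      then have eq: "y' = z" "z' = y" using that by (auto simp: doubleton_eq_iff)
      have "y \<noteq> z" using that(2) star_sub edge_in_verts[OF H, of y z] by (auto simp: nbrs_def)
      moreover have "\<not> beats z y" "\<not> beats y z"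
        using that eq by (auto simp: star_def split: if_splits)
      ultimately show False using beats_total by blast
    qed
    then show ?thesis by (auto simp: inj_on_def)
  qed
  have "star_edges = (\<lambda>(y, z). {y, z}) ` Sigma centers star" by (auto simp: star_edges_def)
  then have "card star_edges = (\<Sum>y\<in>centers. card (star y))"
    using card_image[OF inj] fin by simp
  moreover have "card tree_edges = card \<M> * card (edges F)"
    using bij_betw_same_card[OF bij_tree_edges] by (simp add: card_cartesian_product)
  moreover have "tree_edges \<inter> star_edges = {}"
    by (auto simp: star_edges_def star_def free_def split: if_splits)
  moreover have "finite star_edges" using fin by (simp add: star_edges_def)
  ultimately show ?thesis using fin by (simp add: union_graph_def card_Un_disjoint)
qed

text \<open>A tree edge at \<open>y\<close> comes from the only embedding through \<open>y\<close>,
  hence from one of the at most \<open>\<Delta>\<close> edges of \<open>F\<close> at the preimage of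
  \<open>y\<close>.\<close>

lemma card_free:
  assumes "y \<in> centers"
  shows "card (nbrs H y) \<le> card (free y) + \<Delta>"
proof -
  obtain \<phi> x where y: "\<phi> \<in> \<M>" "x \<in> verts F" "y = \<phi> x" using assms by (auto simp: centers_def)
  have "z \<in> \<phi> ` nbrs F x" if tz: "{y, z} \<in> tree_edges" for z
  proof -
    obtain \<psi> e where e: "\<psi> \<in> \<M>" "e \<in> edges F" "{y, z} = \<psi> ` e" using tz by (auto simp: tree_edges_def)
    then obtain x' where x': "x' \<in> e" "y = \<psi> x'" by (metis imageE insertI1)
    then have eq: "\<psi> = \<phi>" "x' = x"
      using same_embedding[OF e(1) y(1), of x' x] y edge_sub(1)[OF e(2)] by blast+
    then obtain x'' where x'': "e = {x, x''}" "x'' \<in> nbrs F x"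
      using e x' incident_edges[OF F, of x] by blast
    have "y \<noteq> z" using tz tree_edges_sub edge_in_verts[OF H, of y z] by auto
    then have "z = \<phi> x''" using e(3) x'' eq y by (auto simp: doubleton_eq_iff)
    then show ?thesis using x'' by blast
  qed
  then have "nbrs H y \<subseteq> free y \<union> \<phi> ` nbrs F x" by (auto simp: free_def)
  then have "card (nbrs H y) \<le> card (free y \<union> \<phi> ` nbrs F x)"
    using fin finite_nbrs[OF F] by (intro card_mono) auto
  also have "\<dots> \<le> card (free y) + card (nbrs F x)"
    using card_Un_le[of "free y" "\<phi> ` nbrs F x"] card_image_le[OF finite_nbrs[OF F], of \<phi> x] by linarith
  finally show ?thesis using degree[OF y(2)] card_nbrs[OF F, of x] by simp
qed

text \<open>Passing from \<open>free\<close> to \<open>star\<close> loses at most half of the edges,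
  counted with weight \<open>l\<close>: an edge dropped at \<open>y\<close> survives at its other
  end, whose label is at least as large. By \<open>card_free\<close> there are at least
  \<open>lab y - \<Delta>\<close> free edges to start from.\<close>

lemma sum_star_ge:
  fixes l :: "nat \<Rightarrow> real"
  assumes nn: "\<And>y. 0 < lab y \<Longrightarrow> 0 \<le> l (lab y)"
    and mono: "\<And>y z. 0 < lab y \<Longrightarrow> lab y \<le> lab z \<Longrightarrow> l (lab y) \<le> l (lab z)"
  shows "0 \<le> (\<Sum>y | y \<in> centers \<and> 0 < lab y. l (lab y) * (card (star y) - (real (lab y) - \<Delta>) / 2))"
proof -
  let ?S = "{y. y \<in> centers \<and> 0 < lab y}"
  let ?P = "Sigma ?S free" and ?W = "Sigma ?S star"
  let ?l = "\<lambda>(y, z). l (lab y)"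
  have finS: "finite ?S" using fin by simp
  have finP: "finite ?P" using finS fin by auto
  have WP: "?W \<subseteq> ?P" by (auto simp: star_def)
  have swap: "prod.swap ` (?P - ?W) \<subseteq> ?W" and lz: "\<And>y z. (y, z) \<in> ?P - ?W \<Longrightarrow> lab y \<le> lab z"
  proof -
    have *: "(z, y) \<in> ?W \<and> lab y \<le> lab z" if "(y, z) \<in> ?P - ?W" for y z
    proof -
      have yz: "y \<in> centers" "0 < lab y" "z \<in> free y" "z \<in> centers" "beats z y"
        using that by (auto simp: star_def)
      then have "lab y \<le> lab z" by (auto simp: beats_def)
      moreover have "y \<in> free z" using yz(3) by (simp add: free_def nbrs_def insert_commute)
      ultimately show ?thesis using yz beats_asym[of z y] by (auto simp: star_def)
    qed
    show "prod.swap ` (?P - ?W) \<subseteq> ?W"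
    proof (rule image_subsetI)
      fix p assume "p \<in> ?P - ?W"
      then show "prod.swap p \<in> ?W" using *[of "fst p" "snd p"] unfolding prod.swap_def by simp
    qed
    show "\<And>y z. (y, z) \<in> ?P - ?W \<Longrightarrow> lab y \<le> lab z" using * by blast
  qed
  have sumP: "sum ?l ?P = (\<Sum>y\<in>?S. card (free y) * l (lab y))"
    using finS fin by (subst sum.Sigma[symmetric]) auto
  have sumW: "sum ?l ?W = (\<Sum>y\<in>?S. card (star y) * l (lab y))"
    using finS fin by (subst sum.Sigma[symmetric]) auto
  have "sum ?l (?P - ?W) \<le> (\<Sum>p\<in>?P - ?W. ?l (prod.swap p))"
    using lz by (intro sum_mono) (auto intro!: mono)
  also have "\<dots> = sum ?l (prod.swap ` (?P - ?W))"
    by (subst sum.reindex) (auto simp: o_def)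
  also have "\<dots> \<le> sum ?l ?W"
    using finite_subset[OF WP finP] swap nn by (intro sum_mono2) auto
  finally have "sum ?l ?P \<le> 2 * sum ?l ?W"
    using sum.subset_diff[OF WP finP, of ?l] by simp
  then have "(\<Sum>y\<in>?S. card (free y) * l (lab y)) \<le> (\<Sum>y\<in>?S. 2 * (card (star y) * l (lab y)))"
    by (simp add: sumP sumW sum_distrib_left)
  moreover have "(\<Sum>y\<in>?S. (real (lab y) - \<Delta>) * l (lab y)) \<le> (\<Sum>y\<in>?S. card (free y) * l (lab y))"
  proof (intro sum_mono mult_right_mono)
    fix y assume y: "y \<in> ?S"
    then have "lab y \<le> card (free y) + \<Delta>" using card_free[of y] lab[of y] by auto
    then show "real (lab y) - \<Delta> \<le> card (free y)" by linarith
  qed (use nn in auto)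
  ultimately have "0 \<le> (\<Sum>y\<in>?S. 2 * (card (star y) * l (lab y))) - (\<Sum>y\<in>?S. (real (lab y) - \<Delta>) * l (lab y))"
    by linarith
  also have "\<dots> = (\<Sum>y\<in>?S. 2 * (l (lab y) * (card (star y) - (real (lab y) - \<Delta>) / 2)))"
    unfolding sum_subtractf[symmetric] by (intro sum.cong) (auto simp: field_simps)
  finally show ?thesis by (simp flip: sum_distrib_left)
qed

end

text \<open>The label \<open>D\<close> records the degree of the center, and \<open>0\<close> stands for a center of small degree,
  which carries no star. The exponential factor multiplies to at least \<open>1\<close> over the stars cut out of
  \<open>H\<close> (see \<open>sum_star_ge\<close>), and it penalizes labels much larger than the star.\<close>

definition star_weight :: "real \<Rightarrow> nat \<Rightarrow> (nat \<Rightarrow> real) \<Rightarrow> nat \<Rightarrow> nat set \<Rightarrow> real" where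
  "star_weight q \<Delta> l D N =
     (if D = 0 then if N = {} then 1 else 0
      else q ^ card N * exp (l D * (card N - (real D - \<Delta>) / 2)))"

lemma star_weight_nonneg: "0 \<le> q \<Longrightarrow> 0 \<le> star_weight q \<Delta> l D N"
  by (simp add: star_weight_def)

lemma star_weight_image:
  "inj_on f N \<Longrightarrow> star_weight q \<Delta> l D (f ` N) = star_weight q \<Delta> l D N"
  by (simp add: star_weight_def card_image)

section \<open>Copies of the union graph as sets of decorated trees\<close>

context disjoint_embeddings
begin

lemma prod_star_weight_ge:
  assumes q: "0 < q"
    and nn: "\<And>y. 0 < lab y \<Longrightarrow> 0 \<le> l (lab y)"
    and mono: "\<And>y z. 0 < lab y \<Longrightarrow> lab y \<le> lab z \<Longrightarrow> l (lab y) \<le> l (lab z)"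
  shows "q ^ (\<Sum>y\<in>centers. card (star y)) \<le> (\<Prod>y\<in>centers. star_weight q \<Delta> l (lab y) (star y))"
proof -
  let ?t = "\<lambda>y. if 0 < lab y then l (lab y) * (card (star y) - (real (lab y) - \<Delta>) / 2) else 0"
  have "(\<Prod>y\<in>centers. star_weight q \<Delta> l (lab y) (star y)) = (\<Prod>y\<in>centers. q ^ card (star y) * exp (?t y))"
    by (intro prod.cong) (auto simp: star_weight_def star_def)
  also have "\<dots> = q ^ (\<Sum>y\<in>centers. card (star y)) * exp (\<Sum>y\<in>centers. ?t y)"
    using fin by (simp add: prod.distrib power_sum exp_sum)
  also have "(\<Sum>y\<in>centers. ?t y) = (\<Sum>y | y \<in> centers \<and> 0 < lab y. ?t y)"
    using fin by (intro sum.mono_neutral_right) auto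
  also have "\<dots> = (\<Sum>y | y \<in> centers \<and> 0 < lab y. l (lab y) * (card (star y) - (real (lab y) - \<Delta>) / 2))"
    by (intro sum.cong) auto
  finally show ?thesis using sum_star_ge[of l, OF nn mono] q by simp
qed

text \<open>The decorated tree into which a relabelling \<open>f\<close> carries
  \<open>\<phi>\<close>. The image and the star of a vertex are moved by \<open>f\<close>, while its
  label is kept from \<open>H\<close>.\<close>

definition "obj f \<phi> = (\<lambda>x\<in>verts F. (f (\<phi> x) :: nat, lab (\<phi> x), f ` star (\<phi> x)))"

text \<open>This is the left inverse behind the counting: a copy of the union graph is recovered
  from its set of decorated trees, so different copies give different sets.\<close>

definition graph_of :: "('a \<Rightarrow> nat \<times> nat \<times> nat set) set \<Rightarrow> nat ugraph" where
  "graph_of X = Graph (\<Union>b\<in>X. \<Union>x\<in>verts F. insert (fst (b x)) (snd (snd (b x))))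
     (\<Union>b\<in>X. (\<lambda>e. (\<lambda>x. fst (b x)) ` e) ` edges F \<union>
       (\<Union>x\<in>verts F. (\<lambda>z. {fst (b x), z}) ` snd (snd (b x))))"

lemma graph_of_obj:
  "graph_of (obj f ` \<M>) = Graph (f ` verts union_graph) ((`) f ` edges union_graph)"
proof -
  have "(\<Union>b\<in>obj f ` \<M>. \<Union>x\<in>verts F. insert (fst (b x)) (snd (snd (b x)))) =
          (\<Union>\<phi>\<in>\<M>. \<Union>x\<in>verts F. insert (f (\<phi> x)) (f ` star (\<phi> x)))"
    by (simp add: obj_def)
  also have "\<dots> = f ` verts union_graph"
    by (auto simp: union_graph_def centers_def)
  finally have vertices: "(\<Union>b\<in>obj f ` \<M>. \<Union>x\<in>verts F. insert (fst (b x)) (snd (snd (b x)))) =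
    f ` verts union_graph" .
  have im: "(\<lambda>x. fst (obj f \<phi> x)) ` e = f ` \<phi> ` e" if "e \<in> edges F" for \<phi> e
    using edge_sub(1)[OF that] by (auto simp: obj_def image_image subset_iff)
  have "(\<Union>b\<in>obj f ` \<M>. (\<lambda>e. (\<lambda>x. fst (b x)) ` e) ` edges F \<union>
       (\<Union>x\<in>verts F. (\<lambda>z. {fst (b x), z}) ` snd (snd (b x)))) =
      (\<Union>\<phi>\<in>\<M>. (\<lambda>e. f ` \<phi> ` e) ` edges F \<union> (\<Union>x\<in>verts F. (\<lambda>z. f ` {\<phi> x, z}) ` star (\<phi> x)))"
    by (simp add: im image_image cong: image_cong) (simp add: obj_def image_image)
  also have "\<dots> = (`) f ` edges union_graph"
  proof -
    have "(\<Union>\<phi>\<in>\<M>. \<Union>x\<in>verts F. (\<lambda>z. f ` {\<phi> x, z}) ` star (\<phi> x)) = (`) f ` star_edges"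
      unfolding star_edges_def centers_def by blast
    moreover have "(\<Union>\<phi>\<in>\<M>. (\<lambda>e. f ` \<phi> ` e) ` edges F) = (`) f ` tree_edges"
      unfolding tree_edges_def by blast
    ultimately show ?thesis
      unfolding UN_Un_distrib union_graph_def ugraph.sel image_Un by simp
  qed
  finally show ?thesis using vertices by (simp only: graph_of_def)
qed

text \<open>A copy is encoded by \<open>card \<M>\<close> decorated trees whose weights multiply to
  at least \<open>q ^ card (edges union_graph)\<close>, so \<open>sum_prod_subsets_le\<close>
  applies. As the \<open>m\<close>-values of each member sum to at least \<open>j\<close>, the
  weight may carry the factor \<open>exp (- (B * j))\<close>, compensated vertex by vertex by
  \<open>exp (B * m D)\<close>.\<close>

lemma expected_copies_union_graph_le:
  fixes q j B :: real and l m :: "nat \<Rightarrow> real"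
  assumes q: "0 < q" and Hn: "verts H \<subseteq> {..<n}" and B: "0 \<le> B"
    and nn: "\<And>y. 0 < lab y \<Longrightarrow> 0 \<le> l (lab y)"
    and mono: "\<And>y z. 0 < lab y \<Longrightarrow> lab y \<le> lab z \<Longrightarrow> l (lab y) \<le> l (lab z)"
    and Lab: "finite Lab" "lab ` verts H \<subseteq> Lab"
    and j: "\<And>\<phi>. \<phi> \<in> \<M> \<Longrightarrow> j \<le> (\<Sum>x\<in>verts F. m (lab (\<phi> x)))"
  shows "expected_copies n q union_graph \<le>
    exp (exp 1 * (q ^ card (edges F) * exp (- (B * j)) *
      (n * (\<Sum>D\<in>Lab. \<Sum>N\<in>Pow {..<n}. exp (B * m D) * star_weight q \<Delta> l D N)) ^ card (verts F)) - card \<M>)"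
proof -
  let ?V = "verts F" and ?I = union_graph and ?K = "complete_ugraph n"
  let ?g = "\<lambda>(u :: nat, D, N). exp (B * m D) * star_weight q \<Delta> l D N"
  let ?U = "{..<n} \<times> Lab \<times> Pow {..<n}"
  define w where "w b = q ^ card (edges F) * exp (- (B * j)) * (\<Prod>x\<in>?V. ?g (b x))" for b
  \<comment> \<open>Dropping injectivity and all relations between different vertices of
    \<open>F\<close> makes the total weight a power of the weight at a single vertex.\<close>
  define \<O> where "\<O> = ?V \<rightarrow>\<^sub>E ?U"
  have finU: "finite ?U" using Lab by auto
  have finO: "finite \<O>" using fin finU by (auto simp: \<O>_def intro!: finite_PiE)
  have w_nonneg: "0 \<le> w b" for b
    using q star_weight_nonneg[of q]
    by (auto simp: w_def split_def intro!: mult_nonneg_nonneg prod_nonneg)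
  have sumw: "(\<Sum>b\<in>\<O>. w b) = q ^ card (edges F) * exp (- (B * j)) *
      (n * (\<Sum>D\<in>Lab. \<Sum>N\<in>Pow {..<n}. exp (B * m D) * star_weight q \<Delta> l D N)) ^ card ?V"
  proof -
    have "(\<Sum>b\<in>\<O>. \<Prod>x\<in>?V. ?g (b x)) = (\<Sum>u\<in>?U. ?g u) ^ card ?V"
      using prod_sum_PiE[of ?V "\<lambda>_. ?U" "\<lambda>_. ?g"] fin finU by (simp add: \<O>_def)
    also have "(\<Sum>u\<in>?U. ?g u) = n * (\<Sum>D\<in>Lab. \<Sum>N\<in>Pow {..<n}. exp (B * m D) * star_weight q \<Delta> l D N)"
      by (simp add: sum.cartesian_product' )
    finally show ?thesis by (simp only: w_def sum_distrib_left[symmetric])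
  qed
  have I_sub: "star (\<phi> x) \<subseteq> verts ?I" "\<phi> x \<in> verts ?I" if "\<phi> \<in> \<M>" "x \<in> ?V" for \<phi> x
    using that by (auto simp: union_graph_def centers_def)
  have inj_obj: "inj_on (obj f) \<M>" if f: "inj_on f (verts ?I)" for f
  proof (rule inj_onI)
    fix \<phi> \<psi> assume *: "\<phi> \<in> \<M>" "\<psi> \<in> \<M>" "obj f \<phi> = obj f \<psi>"
    obtain x where x: "x \<in> ?V" using F_nonempty by blast
    have "f (\<phi> x) = f (\<psi> x)" using fun_cong[OF *(3), of x] x by (simp add: obj_def)
    then have "\<phi> x = \<psi> x" using f I_sub * x by (auto dest: inj_onD)
    then show "\<phi> = \<psi>" using same_embedding * x by blast
  qed
  have weight: "q ^ card (edges ?I) \<le> (\<Prod>b\<in>obj f ` \<M>. w b)" if f: "inj_on f (verts ?I)" for f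
  proof -
    have "q ^ card (edges ?I) =
        (q ^ card (edges F)) ^ card \<M> * q ^ (\<Sum>y\<in>centers. card (star y))"
      by (simp add: card_union_edges power_add power_mult[symmetric] mult.commute)
    also have "\<dots> \<le> (q ^ card (edges F)) ^ card \<M> * (\<Prod>y\<in>centers. star_weight q \<Delta> l (lab y) (star y))"
      using prod_star_weight_ge[of q l, OF q nn mono] q by (intro mult_left_mono) auto
    also have "\<dots> = (\<Prod>\<phi>\<in>\<M>. q ^ card (edges F) * (\<Prod>x\<in>?V. star_weight q \<Delta> l (lab (\<phi> x)) (star (\<phi> x))))"
      by (simp add: prod_centers prod.distrib)
    also have "\<dots> \<le> (\<Prod>\<phi>\<in>\<M>. w (obj f \<phi>))"
    proof (intro prod_mono conjI)
      fix \<phi> assume p: "\<phi> \<in> \<M>"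
      let ?s = "\<Prod>x\<in>?V. star_weight q \<Delta> l (lab (\<phi> x)) (star (\<phi> x))"
      have s: "0 \<le> ?s" using q by (intro prod_nonneg star_weight_nonneg) auto
      then show "0 \<le> q ^ card (edges F) * ?s" using q by simp
      have "star_weight q \<Delta> l D (f ` star (\<phi> x)) = star_weight q \<Delta> l D (star (\<phi> x))" if "x \<in> ?V" for x D
        using inj_on_subset[OF f I_sub(1)[OF p that]] by (rule star_weight_image)
      then have "(\<Prod>x\<in>?V. ?g (obj f \<phi> x)) = (\<Prod>x\<in>?V. exp (B * m (lab (\<phi> x))) * star_weight q \<Delta> l (lab (\<phi> x)) (star (\<phi> x)))"
        by (intro prod.cong) (auto simp: obj_def)
      also have "\<dots> = exp (B * (\<Sum>x\<in>?V. m (lab (\<phi> x)))) * ?s"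
        using fin by (simp add: prod.distrib exp_sum sum_distrib_left)
      finally have "w (obj f \<phi>) = q ^ card (edges F) * ?s * exp (B * ((\<Sum>x\<in>?V. m (lab (\<phi> x))) - j))"
        by (simp add: w_def algebra_simps exp_diff exp_minus divide_inverse)
      moreover have "1 \<le> exp (B * ((\<Sum>x\<in>?V. m (lab (\<phi> x))) - j))"
        using B j[OF p] by simp
      ultimately show "q ^ card (edges F) * ?s \<le> w (obj f \<phi>)"
        using \<open>0 \<le> q ^ card (edges F) * ?s\<close> mult_left_mono[of 1 _ "q ^ card (edges F) * ?s"] by simp
    qed
    also have "\<dots> = (\<Prod>b\<in>obj f ` \<M>. w b)" by (simp add: prod.reindex[OF inj_obj[OF f]])
    finally show ?thesis .
  qed
  have "\<exists>f. inj_on f (verts ?I) \<and> f ` verts ?I \<subseteq> {..<n} \<and> graph_of (obj f ` \<M>) = C"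
    if C: "C \<in> copies ?K ?I" for C
  proof -
    have "isomorphic ?I C" using C by (auto simp: copies_def subgraph_def intro: isomorphic_sym)
    then obtain f where f: "bij_betw f (verts ?I) (verts C)" "edges C = (`) f ` edges ?I"
      by (auto simp: isomorphic_def)
    moreover have "verts C \<subseteq> {..<n}" using C by (auto simp: copies_def subgraph_def complete_ugraph_def)
    ultimately show ?thesis by (cases C) (auto simp: graph_of_obj bij_betw_def)
  qed
  \<comment> \<open>One relabelling is chosen for each copy. Any choice serves, since
    \<open>graph_of\<close> recovers the copy.\<close>
  then obtain f where f: "\<And>C. C \<in> copies ?K ?I \<Longrightarrow> inj_on (f C) (verts ?I)"
    "\<And>C. C \<in> copies ?K ?I \<Longrightarrow> f C ` verts ?I \<subseteq> {..<n}"
    "\<And>C. C \<in> copies ?K ?I \<Longrightarrow> graph_of (obj (f C) ` \<M>) = C" by metis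
  let ?A = "\<lambda>C. obj (f C) ` \<M>"
  have inj: "inj_on ?A (copies ?K ?I)" by (rule inj_on_inverseI[where g = graph_of]) (simp add: f)
  have "expected_copies n q ?I = (\<Sum>C\<in>copies ?K ?I. q ^ card (edges ?I))"
    by (simp add: expected_copies_def num_copies_def)
  also have "\<dots> \<le> (\<Sum>C\<in>copies ?K ?I. \<Prod>b\<in>?A C. w b)"
    by (intro sum_mono weight f)
  also have "\<dots> = (\<Sum>X\<in>?A ` copies ?K ?I. \<Prod>b\<in>X. w b)"
    by (simp add: sum.reindex[OF inj])
  also have "\<dots> \<le> exp (exp 1 * (\<Sum>b\<in>\<O>. w b) - card \<M>)"
  proof (rule sum_prod_subsets_le[OF finO w_nonneg])
    have "obj (f C) \<phi> \<in> \<O>" if C: "C \<in> copies ?K ?I" and p: "\<phi> \<in> \<M>" for C \<phi>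
    proof -
      have "lab (\<phi> x) \<in> Lab" if "x \<in> ?V" for x
      proof -
        have "\<phi> x \<in> verts H" using centers_sub that p by (auto simp: centers_def)
        then show ?thesis using Lab(2) by blast
      qed
      moreover have "f C (\<phi> x) < n" "f C ` star (\<phi> x) \<subseteq> {..<n}" if "x \<in> ?V" for x
        using f(2)[OF C] I_sub[OF p that] by auto
      ultimately show ?thesis unfolding \<O>_def obj_def by (intro restrict_PiE_iff[THEN iffD2]) auto
    qed
    then show "?A ` copies ?K ?I \<subseteq> Pow \<O>" by blast
    show "card X = card \<M>" if "X \<in> ?A ` copies ?K ?I" for X
      using that by (auto simp: card_image[OF inj_obj[OF f(1)]])
  qed
  finally show ?thesis by (simp only: sumw)
qed

end

subsection \<open>Summing over labels and stars\<close>

lemma sum_exp_neg_nat_le: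
  assumes "finite A"
  shows "(\<Sum>k\<in>A. exp (- real k)) \<le> 2"
proof -
  have "exp (- real k) \<le> (1 / 2) ^ k" for k :: nat
  proof -
    have "2 ^ k \<le> exp (1::real) ^ k" using exp_ge_add_one_self[of 1] by (intro power_mono) auto
    then show ?thesis by (simp add: exp_minus power_one_over field_simps flip: exp_of_nat_mult)
  qed
  then have "(\<Sum>k\<in>A. exp (- real k)) \<le> (\<Sum>k\<in>A. (1 / 2) ^ k)" by (rule sum_mono)
  also have "\<dots> \<le> (\<Sum>k. (1 / 2 :: real) ^ k)"
    using assms by (intro sum_le_suminf) (auto simp: summable_geometric)
  also have "\<dots> = 2" by (simp add: suminf_geometric)
  finally show ?thesis .
qed

text \<open>With the constant factor taken out, the sum over all stars expands a product with one
  factor for each of the \<open>n\<close> potential neighbours.\<close>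

lemma sum_star_weight:
  assumes "0 < D"
  shows "(\<Sum>N\<in>Pow {..<n}. star_weight q \<Delta> l D N) =
           exp (- (l D * (real D - \<Delta>) / 2)) * (1 + q * exp (l D)) ^ n"
proof -
  have eq: "exp (l D * (real c - (real D - \<Delta>) / 2)) = exp (- (l D * (real D - \<Delta>) / 2)) * exp (l D) ^ c" for c
    by (simp only: exp_of_nat_mult[symmetric] exp_add[symmetric]) (simp add: field_simps)
  have "(\<Sum>N\<in>Pow {..<n}. star_weight q \<Delta> l D N) =
      (\<Sum>N\<in>Pow {..<n}. exp (- (l D * (real D - \<Delta>) / 2)) * (\<Prod>a\<in>N. q * exp (l D)))"
    using assms
    by (intro sum.cong) (simp_all add: star_weight_def power_mult_distrib eq mult_ac)
  also have "\<dots> = exp (- (l D * (real D - \<Delta>) / 2)) * (\<Prod>a<n. 1 + q * exp (l D))"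
    by (simp only: prod_one_plus[OF finite_lessThan] sum_distrib_left)
  finally show ?thesis by simp
qed

text \<open>Put \<open>t = D / \<Lambda>\<close> and \<open>u = ln t\<close>. The subtracted term is
  about \<open>u * D / 4\<close>. The threshold \<open>K * \<Lambda>\<close> forces
  \<open>B \<le> D / 1024\<close> and \<open>t > 2048\<close>, so the first term is at most
  \<open>u * D / 1024\<close> and the last, \<open>lam * sqrt t\<close>, at most
  \<open>D / 32\<close>. As \<open>u \<ge> 6\<close>, the subtracted term wins.\<close>

lemma star_exponent_le:
  fixes \<Lambda> lam K B D :: real
  assumes L: "1 \<le> \<Lambda>" "0 \<le> lam" "lam \<le> \<Lambda>" and K: "K = 1024 * (real \<Delta> + 2)"
    and D: "K * \<Lambda> < D" and B: "B = real \<Delta> + 1 + \<Lambda>"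
  shows "B * max 0 (ln (D / (K * \<Lambda>))) - ln (D / \<Lambda>) / 2 * (D - \<Delta>) / 2 + lam * exp (ln (D / \<Lambda>) / 2) \<le> - D"
proof -
  define t where "t = D / \<Lambda>"
  define u where "u = ln t"
  have K1: "2048 \<le> K" using K by simp
  have Dt: "D = t * \<Lambda>" using L by (simp add: t_def)
  have tK: "K < t" using D L by (simp add: t_def field_simps)
  have t: "2048 < t" using tK K1 by simp
  have D0: "0 < D" using Dt t L by simp
  have "exp (6::real) = exp 1 ^ 6" by (simp flip: exp_of_nat_mult)
  also have "\<dots> \<le> 3 ^ 6" using exp_le by (intro power_mono) auto
  finally have "exp 6 \<le> t" using t by simp
  then have u6: "6 \<le> u" unfolding u_def using t by (subst ln_ge_iff) auto
  have m: "max 0 (ln (D / (K * \<Lambda>))) \<le> u"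
  proof -
    have "ln (D / (K * \<Lambda>)) \<le> u"
      unfolding u_def using D0 K1 L Dt t
      by (subst ln_le_cancel_iff) (auto simp: field_simps)
    then show ?thesis using u6 by simp
  qed
  have KL: "1024 * ((real \<Delta> + 2) * \<Lambda>) < D" using D unfolding K by (simp only: mult.assoc)
  have \<Delta>L: "real \<Delta> \<le> real \<Delta> * \<Lambda>" using L mult_left_mono[of 1 \<Lambda> "real \<Delta>"] by simp
  have BD: "1024 * B \<le> D" and \<Delta>D: "1024 * real \<Delta> \<le> D"
    using KL \<Delta>L L(1) B by (simp_all add: algebra_simps)
  have "B * max 0 (ln (D / (K * \<Lambda>))) \<le> B * u" using m B L by (intro mult_left_mono) auto
  also have "\<dots> \<le> D / 1024 * u" using BD u6 by (intro mult_right_mono) auto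
  finally have 1: "B * max 0 (ln (D / (K * \<Lambda>))) \<le> u * D / 1024" by (simp add: mult.commute)
  have 2: "u / 2 * (D - \<Delta>) / 2 \<ge> u * D * (1023 / 4096)"
  proof -
    have "u * (D * (1023 / 1024)) \<le> u * (D - \<Delta>)" using \<Delta>D u6 by (intro mult_left_mono) auto
    then show ?thesis by (simp add: algebra_simps)
  qed
  have 3: "lam * exp (u / 2) \<le> D / 32"
  proof -
    have "exp (u / 2) = exp (ln (sqrt t))" using t by (simp add: u_def ln_sqrt)
    then have s: "exp (u / 2) = sqrt t" using t by simp
    have "32 \<le> sqrt t" using t by (intro real_le_rsqrt) auto
    then have "32 * sqrt t \<le> t" using mult_right_mono[of 32 "sqrt t" "sqrt t"] t by simp
    then have "\<Lambda> * (32 * sqrt t) \<le> \<Lambda> * t" using L by (intro mult_left_mono) auto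
    moreover have "lam * sqrt t \<le> \<Lambda> * sqrt t" using L t by (intro mult_right_mono) auto
    ultimately show ?thesis using s Dt by (simp add: mult.commute)
  qed
  have "6 * D \<le> u * D" using u6 D0 by simp
  then have "B * max 0 (ln (D / (K * \<Lambda>))) - u / 2 * (D - \<Delta>) / 2 + lam * exp (u / 2) \<le> - D"
    using 1 2 3 D0 by linarith
  then show ?thesis by (simp only: u_def t_def)
qed

text \<open>Label \<open>0\<close> contributes 1. By \<open>star_exponent_le\<close> a label
  \<open>D\<close> above the threshold contributes at most \<open>exp (- D)\<close>, and these terms
  sum to at most 2.\<close>

lemma sum_labelled_star_weight_le:
  fixes \<Lambda> q K B :: real and l m :: "nat \<Rightarrow> real"
  assumes L: "1 \<le> \<Lambda>" "0 < q" "n * q \<le> \<Lambda>" and K: "K = 1024 * (real \<Delta> + 2)"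
    and B: "B = real \<Delta> + 1 + \<Lambda>"
    and l: "l = (\<lambda>D. ln (D / \<Lambda>) / 2)" and m: "m = (\<lambda>D. max 0 (ln (D / (K * \<Lambda>))))"
    and Lab: "finite Lab" "\<And>D. D \<in> Lab \<Longrightarrow> D = 0 \<or> K * \<Lambda> < real D"
  shows "(\<Sum>D\<in>Lab. \<Sum>N\<in>Pow {..<n}. exp (B * m D) * star_weight q \<Delta> l D N) \<le> 3"
proof -
  let ?s = "\<lambda>D. \<Sum>N\<in>Pow {..<n}. exp (B * m D) * star_weight q \<Delta> l D N"
  have pos: "?s D \<le> exp (- real D)" if D: "D \<in> Lab" "D \<noteq> 0" for D
  proof -
    have "?s D = exp (B * m D) * (exp (- (l D * (real D - \<Delta>) / 2)) * (1 + q * exp (l D)) ^ n)"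
      using sum_star_weight[of D] D by (simp flip: sum_distrib_left)
    also have "\<dots> \<le> exp (B * m D) * (exp (- (l D * (real D - \<Delta>) / 2)) * exp (q * exp (l D)) ^ n)"
      using L by (intro mult_left_mono power_mono) auto
    also have "\<dots> = exp (B * m D - l D * (real D - \<Delta>) / 2 + (n * q) * exp (l D))"
      by (simp only: exp_of_nat_mult[symmetric] exp_add[symmetric]) (simp add: mult.assoc)
    also have "\<dots> \<le> exp (- real D)"
      using star_exponent_le[OF L(1) _ L(3) K, of "real D" B] Lab(2)[OF D(1)] D L B
      by (simp add: l m)
    finally show ?thesis .
  qed
  \<comment> \<open>The convention \<open>ln 0 = 0\<close> gives \<open>m 0 = 0\<close>, and with
    label \<open>0\<close> only the empty star has positive weight.\<close>
  have zero: "?s 0 = 1"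
  proof -
    have "?s 0 = (\<Sum>N\<in>Pow {..<n}. if N = {} then 1 else 0)"
      by (intro sum.cong) (auto simp: star_weight_def m)
    also have "\<dots> = (\<Sum>N\<in>{{}::nat set}. 1)"
      by (intro sum.mono_neutral_cong_right) auto
    also have "\<dots> = 1" by simp
    finally show ?thesis .
  qed
  have nn: "0 \<le> ?s D" for D using L by (intro sum_nonneg mult_nonneg_nonneg star_weight_nonneg) auto
  have "(\<Sum>D\<in>Lab. ?s D) \<le> (\<Sum>D\<in>insert 0 Lab. ?s D)"
    using Lab nn by (intro sum_mono2) auto
  also have "\<dots> = 1 + (\<Sum>D\<in>Lab - {0}. ?s D)" using Lab zero by (simp add: sum.insert_remove)
  also have "(\<Sum>D\<in>Lab - {0}. ?s D) \<le> (\<Sum>D\<in>Lab - {0}. exp (- real D))"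
    using pos by (intro sum_mono) auto
  also have "\<dots> \<le> 2" using Lab by (intro sum_exp_neg_nat_le) auto
  finally show ?thesis by simp
qed

subsection \<open>Counting embeddings by level\<close>

lemma maximal_disjoint_family:
  fixes V :: "'a set" and \<A> :: "('a \<Rightarrow> 'b) set"
  assumes "finite \<A>" "V \<noteq> {}"
  obtains \<M> where "\<M> \<subseteq> \<A>"
    "\<And>\<phi> \<psi>. \<phi> \<in> \<M> \<Longrightarrow> \<psi> \<in> \<M> \<Longrightarrow> \<phi> \<noteq> \<psi> \<Longrightarrow> \<phi> ` V \<inter> \<psi> ` V = {}"
    "\<And>\<phi>. \<phi> \<in> \<A> \<Longrightarrow> \<exists>\<psi>\<in>\<M>. \<exists>x\<in>V. \<exists>x'\<in>V. \<phi> x = \<psi> x'"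
proof -
  define P where "P = {\<M>. \<M> \<subseteq> \<A> \<and> (\<forall>\<phi>\<in>\<M>. \<forall>\<psi>\<in>\<M>. \<phi> \<noteq> \<psi> \<longrightarrow> \<phi> ` V \<inter> \<psi> ` V = {})}"
  have "finite P" by (rule finite_subset[of _ "Pow \<A>"]) (use assms in \<open>auto simp: P_def\<close>)
  moreover have "{} \<in> P" by (simp add: P_def)
  ultimately obtain \<M> where M: "\<M> \<in> P" and max: "\<And>\<N>. \<N> \<in> P \<Longrightarrow> \<M> \<subseteq> \<N> \<Longrightarrow> \<M> = \<N>"
    using finite_has_maximal[of P] by blast
  have "\<exists>\<psi>\<in>\<M>. \<exists>x\<in>V. \<exists>x'\<in>V. \<phi> x = \<psi> x'" if p: "\<phi> \<in> \<A>" for \<phi>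
  proof (rule ccontr)
    assume *: "\<not> ?thesis"
    then have d: "\<phi> ` V \<inter> \<psi> ` V = {}" if "\<psi> \<in> \<M>" for \<psi> using that by blast
    then have "insert \<phi> \<M> \<in> P" using M p unfolding P_def by blast
    then have "\<phi> \<in> \<M>" using max by blast
    then show False using d assms(2) by blast
  qed
  then show ?thesis using that[of \<M>] M unfolding P_def by blast
qed

locale sparse_tree_host =
  fixes F :: "'a ugraph" and H :: "nat ugraph" and n \<Delta> :: nat and q :: real
  assumes F: "simple_graph F" "connected_graph F" and tree: "Suc (card (edges F)) = card (verts F)"
    and degree: "\<And>x. x \<in> verts F \<Longrightarrow> vertex_degree F x \<le> \<Delta>"
    and HK: "subgraph H (complete_ugraph n)" and sparse: "q_sparse n q H" and q: "0 < q"
begin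

definition "\<Lambda> = max 1 (n * q)"
text \<open>The factor 1024 is the slack that \<open>star_exponent_le\<close> needs at vertices of
  degree above \<open>K * \<Lambda>\<close>.\<close>

definition "K = 1024 * (real \<Delta> + 2)"
definition "\<mu> y = max 0 (ln (card (nbrs H y) / (K * \<Lambda>)))"
definition "level \<phi> = (\<Sum>x\<in>verts F. \<mu> (\<phi> x))"

lemma H: "simple_graph H" and H_verts: "verts H \<subseteq> {..<n}"
  using HK by (auto simp: subgraph_def complete_ugraph_def)

lemma \<Lambda>_ge: "1 \<le> \<Lambda>" "n * q \<le> \<Lambda>" and K_ge: "2048 \<le> K" and KL_pos: "0 < K * \<Lambda>"
  by (auto simp: \<Lambda>_def K_def intro!: mult_pos_pos)

lemma \<mu>_nonneg: "0 \<le> \<mu> y"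
  by (simp add: \<mu>_def)

lemma card_nbrs_le: "card (nbrs H y) \<le> K * \<Lambda> * exp (\<mu> y)"
proof (cases "card (nbrs H y) = 0")
  case False
  have "card (nbrs H y) / (K * \<Lambda>) = exp (ln (card (nbrs H y) / (K * \<Lambda>)))"
    using False KL_pos by (subst exp_ln) auto
  also have "\<dots> \<le> exp (\<mu> y)" by (simp add: \<mu>_def)
  finally show ?thesis using KL_pos by (simp add: field_simps)
qed (use KL_pos in auto)

lemma fin_emb: "finite (embeddings F H)"
  by (rule finite_embeddings[OF F(1) H])

lemma F_verts: "finite (verts F)" "verts F \<noteq> {}"
  using F by (auto simp: simple_graph_def connected_graph_def)

lemma level_nonneg: "0 \<le> level \<phi>"
  by (simp add: level_def sum_nonneg \<mu>_nonneg)

lemma card_rooted_le: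
  fixes b :: real
  assumes "x \<in> verts F"
  shows "card {\<phi> \<in> embeddings F H. \<phi> x = u \<and> level \<phi> \<le> b} \<le> (K * \<Lambda>) ^ card (edges F) * exp (real \<Delta> * b)"
proof -
  have "card (verts F) - 1 = card (edges F)" using tree by simp
  then show ?thesis
    using card_rooted_embeddings_le[OF F H assms degree \<mu>_nonneg card_nbrs_le, of u b] KL_pos
    by (simp add: level_def)
qed

lemma card_low_level_le:
  fixes b :: real
  shows "card {\<phi> \<in> embeddings F H. level \<phi> \<le> b} \<le> n * ((K * \<Lambda>) ^ card (edges F) * exp (real \<Delta> * b))"
proof -
  obtain x where x: "x \<in> verts F" using F_verts by blast
  have "{\<phi> \<in> embeddings F H. level \<phi> \<le> b} \<subseteq> (\<Union>u<n. {\<phi> \<in> embeddings F H. \<phi> x = u \<and> level \<phi> \<le> b})"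
    using x H_verts by (fastforce simp: embeddings_def)
  then have "card {\<phi> \<in> embeddings F H. level \<phi> \<le> b} \<le> card (\<Union>u<n. {\<phi> \<in> embeddings F H. \<phi> x = u \<and> level \<phi> \<le> b})"
    using fin_emb by (intro card_mono) auto
  also have "\<dots> \<le> (\<Sum>u<n. card {\<phi> \<in> embeddings F H. \<phi> x = u \<and> level \<phi> \<le> b})"
    by (rule card_UN_le) simp
  finally have "real (card {\<phi> \<in> embeddings F H. level \<phi> \<le> b}) \<le>
      (\<Sum>u<n. real (card {\<phi> \<in> embeddings F H. \<phi> x = u \<and> level \<phi> \<le> b}))"
    by (simp flip: of_nat_sum)
  also have "\<dots> \<le> (\<Sum>u<n. (K * \<Lambda>) ^ card (edges F) * exp (real \<Delta> * b))"
    by (intro sum_mono card_rooted_le x)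
  finally show ?thesis by simp
qed

text \<open>Sparsity enters here: the union graph of the family is a subgraph of \<open>H\<close>,
  so its expectation is at least 1 and the exponent in \<open>expected_copies_union_graph_le\<close>
  cannot be negative.\<close>

lemma card_disjoint_family_le:
  fixes j :: real
  assumes M: "\<M> \<subseteq> embeddings F H"
    and disj: "\<And>\<phi> \<psi>. \<phi> \<in> \<M> \<Longrightarrow> \<psi> \<in> \<M> \<Longrightarrow> \<phi> \<noteq> \<psi> \<Longrightarrow> \<phi> ` verts F \<inter> \<psi> ` verts F = {}"
    and j: "\<And>\<phi>. \<phi> \<in> \<M> \<Longrightarrow> j \<le> level \<phi>"
  shows "card \<M> \<le> exp 1 * (q ^ card (edges F) * exp (- ((real \<Delta> + 1 + \<Lambda>) * j)) * (3 * real n) ^ card (verts F))"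
proof -
  define lab where "lab y = (if K * \<Lambda> < card (nbrs H y) then card (nbrs H y) else 0)" for y
  define l :: "nat \<Rightarrow> real" where "l = (\<lambda>D. ln (D / \<Lambda>) / 2)"
  define m :: "nat \<Rightarrow> real" where "m = (\<lambda>D. max 0 (ln (D / (K * \<Lambda>))))"
  \<comment> \<open>The summands of \<open>B\<close> serve \<open>card_level_le\<close>:
    \<open>\<Delta>\<close> cancels the growth of \<open>card_rooted_le\<close> with the level,
    \<open>1\<close> leaves a summable \<open>exp (- j)\<close>, and \<open>\<Lambda>\<close> yields
    \<open>exp (- (\<Lambda> * j))\<close>.\<close>
  define B where "B = real \<Delta> + 1 + \<Lambda>"
  define Lab where "Lab = lab ` verts H"
  let ?S = "\<Sum>D\<in>Lab. \<Sum>N\<in>Pow {..<n}. exp (B * m D) * star_weight q \<Delta> l D N"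
  interpret disjoint_embeddings F H \<M> lab \<Delta>
    by unfold_locales (use F F_verts H M disj degree in \<open>auto simp: lab_def\<close>)
  \<comment> \<open>Up to the threshold both sides are \<open>0\<close>, so replacing a small degree
    by the label \<open>0\<close> does not change the level.\<close>
  have m: "m (lab y) = \<mu> y" for y
  proof (cases "K * \<Lambda> < card (nbrs H y)")
    case False
    then have "card (nbrs H y) = 0 \<or> ln (card (nbrs H y) / (K * \<Lambda>)) \<le> 0"
      using KL_pos by (cases "card (nbrs H y) = 0") (auto simp: ln_le_zero_iff)
    then show ?thesis using False by (auto simp: m_def \<mu>_def lab_def)
  qed (simp add: m_def \<mu>_def lab_def)
  have lab_gt: "\<Lambda> < lab y" if "0 < lab y" for y
  proof -
    have "1 * \<Lambda> \<le> K * \<Lambda>" using K_ge \<Lambda>_ge(1) by (intro mult_right_mono) auto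
    moreover have "K * \<Lambda> < lab y" using that by (simp add: lab_def split: if_splits)
    ultimately show ?thesis by linarith
  qed
  have "1 \<le> expected_copies n q union_graph"
    using sparse union_graph_sub by (simp add: q_sparse_def)
  also have "\<dots> \<le> exp (exp 1 * (q ^ card (edges F) * exp (- (B * j)) * (n * ?S) ^ card (verts F)) - card \<M>)"
  proof (rule expected_copies_union_graph_le[OF q H_verts])
    show "0 \<le> B" using \<Lambda>_ge by (simp add: B_def)
    show "0 \<le> l (lab y)" if "0 < lab y" for y
      using lab_gt[OF that] \<Lambda>_ge by (simp add: l_def)
    show "l (lab y) \<le> l (lab z)" if "0 < lab y" "lab y \<le> lab z" for y z
      using that \<Lambda>_ge by (simp add: l_def divide_right_mono)
    show "finite Lab" using H by (simp add: Lab_def simple_graph_def)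
    show "j \<le> (\<Sum>x\<in>verts F. m (lab (\<phi> x)))" if "\<phi> \<in> \<M>" for \<phi>
      using j[OF that] by (simp add: m level_def)
  qed (simp add: Lab_def)
  finally have "card \<M> \<le> exp 1 * (q ^ card (edges F) * exp (- (B * j)) * (n * ?S) ^ card (verts F))"
    by simp
  also have "\<dots> \<le> exp 1 * (q ^ card (edges F) * exp (- (B * j)) * (real n * 3) ^ card (verts F))"
  proof -
    have "?S \<le> 3"
      by (rule sum_labelled_star_weight_le[OF \<Lambda>_ge(1) q \<Lambda>_ge(2) K_def B_def l_def m_def])
        (use H in \<open>auto simp: Lab_def lab_def simple_graph_def split: if_splits\<close>)
    moreover have "0 \<le> ?S"
      using q by (intro sum_nonneg mult_nonneg_nonneg star_weight_nonneg) auto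
    ultimately have "(real n * ?S) ^ card (verts F) \<le> (real n * 3) ^ card (verts F)"
      by (intro power_mono mult_left_mono) auto
    then show ?thesis using q by (intro mult_left_mono) auto
  qed
  finally show ?thesis by (simp add: B_def mult.commute)
qed

text \<open>Above level \<open>card (verts F)\<close> the factor \<open>exp (- \<Lambda> * j)\<close> gained from the stars pays for the
  number \<open>\<Lambda> ^ card (edges F)\<close> of ways to grow a tree.\<close>

lemma card_level_le:
  fixes j :: nat
  assumes j: "\<Lambda> = 1 \<or> card (verts F) \<le> j"
  shows "card {\<phi> \<in> embeddings F H. j \<le> level \<phi> \<and> level \<phi> \<le> real j + 1} \<le>
    n * (n * q) ^ card (edges F) * ((12 * K) ^ card (verts F) * exp (real \<Delta> + 1)) * exp (- real j)"
proof -
  let ?A = "{\<phi> \<in> embeddings F H. j \<le> level \<phi> \<and> level \<phi> \<le> real j + 1}"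
  let ?V = "verts F" and ?v = "card (verts F)" and ?k = "card (edges F)"
  obtain \<M> where M: "\<M> \<subseteq> ?A"
    "\<And>\<phi> \<psi>. \<phi> \<in> \<M> \<Longrightarrow> \<psi> \<in> \<M> \<Longrightarrow> \<phi> \<noteq> \<psi> \<Longrightarrow> \<phi> ` ?V \<inter> \<psi> ` ?V = {}"
    "\<And>\<phi>. \<phi> \<in> ?A \<Longrightarrow> \<exists>\<psi>\<in>\<M>. \<exists>x\<in>?V. \<exists>x'\<in>?V. \<phi> x = \<psi> x'"
    using maximal_disjoint_family[of ?A ?V] fin_emb F_verts by auto
  have finM: "finite \<M>" using M(1) fin_emb finite_subset by fastforce
  let ?R = "\<lambda>x u. {\<phi> \<in> embeddings F H. \<phi> x = u \<and> level \<phi> \<le> real j + 1}"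
  \<comment> \<open>An embedding that meets a member \<open>\<psi>\<close> of \<open>\<M>\<close>
    can be rooted at a vertex of \<open>\<psi>\<close>; the pair \<open>(x, x')\<close> records
    which vertices of \<open>F\<close> are mapped to the common point.\<close>
  have "?A \<subseteq> (\<Union>(\<psi>, x, x')\<in>\<M> \<times> ?V \<times> ?V. ?R x (\<psi> x'))"
    using M(3) by fastforce
  then have "card ?A \<le> card (\<Union>(\<psi>, x, x')\<in>\<M> \<times> ?V \<times> ?V. ?R x (\<psi> x'))"
    using finM F_verts fin_emb by (intro card_mono) auto
  also have "\<dots> \<le> (\<Sum>(\<psi>, x, x')\<in>\<M> \<times> ?V \<times> ?V. card (?R x (\<psi> x')))"
    using card_UN_le[of "\<M> \<times> ?V \<times> ?V" "\<lambda>(\<psi>, x, x'). ?R x (\<psi> x')"] finM F_verts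
    by (simp add: split_def)
  finally have "real (card ?A) \<le> real (\<Sum>(\<psi>, x, x')\<in>\<M> \<times> ?V \<times> ?V. card (?R x (\<psi> x')))"
    by (rule of_nat_mono)
  also have "\<dots> = (\<Sum>(\<psi>, x, x')\<in>\<M> \<times> ?V \<times> ?V. real (card (?R x (\<psi> x'))))"
    by (simp add: split_def)
  also have "\<dots> \<le> (\<Sum>(\<psi>, x, x')\<in>\<M> \<times> ?V \<times> ?V. (K * \<Lambda>) ^ ?k * exp (real \<Delta> * (real j + 1)))"
    using card_rooted_le[where b = "real j + 1"] by (intro sum_mono) (auto simp: add.commute)
  also have "\<dots> = card \<M> * (?v * ?v * ((K * \<Lambda>) ^ ?k * exp (real \<Delta> * (real j + 1))))"
    by (simp add: card_cartesian_product split_def)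
  also have "\<dots> \<le> exp 1 * (q ^ ?k * exp (- ((real \<Delta> + 1 + \<Lambda>) * j)) * (3 * real n) ^ ?v) *
      (4 ^ ?v * ((K * \<Lambda>) ^ ?k * exp (real \<Delta> * (real j + 1))))"
  proof (rule mult_mono)
    show "card \<M> \<le> exp 1 * (q ^ ?k * exp (- ((real \<Delta> + 1 + \<Lambda>) * j)) * (3 * real n) ^ ?v)"
      using card_disjoint_family_le[of \<M> "real j"] M by auto
    have "?v < 2 ^ ?v" by (rule less_exp)
    then have "real ?v \<le> 2 ^ ?v" by (metis less_imp_le of_nat_le_iff of_nat_numeral of_nat_power)
    then have "real ?v * ?v \<le> 2 ^ ?v * 2 ^ ?v" by (intro mult_mono) auto
    also have "\<dots> = (4::real) ^ ?v" by (simp flip: power_mult_distrib)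
    finally show "?v * ?v * ((K * \<Lambda>) ^ ?k * exp (real \<Delta> * (real j + 1))) \<le> 4 ^ ?v * ((K * \<Lambda>) ^ ?k * exp (real \<Delta> * (real j + 1)))"
      using KL_pos by (intro mult_right_mono) auto
  qed (use KL_pos q in auto)
  \<comment> \<open>The bases \<open>3\<close> and \<open>4\<close> combine to \<open>12\<close>,
    one factor \<open>n\<close> splits off because \<open>F\<close> has one more vertex than edges,
    and the exponents add up to \<open>\<Delta> + 1 - j - \<Lambda> * j\<close>.\<close>
  also have "\<dots> = n * (n * q) ^ ?k * (12 ^ ?v * K ^ ?k * exp (real \<Delta> + 1)) * exp (- real j) * (\<Lambda> ^ ?k * exp (- (\<Lambda> * j)))"
  proof -
    have e: "exp 1 * exp (- ((real \<Delta> + 1 + \<Lambda>) * j)) * exp (real \<Delta> * (real j + 1)) =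
        exp (real \<Delta> + 1) * exp (- real j) * exp (- (\<Lambda> * j))"
      by (simp only: exp_add[symmetric]) (simp add: algebra_simps)
    have "(12::real) ^ ?v = 3 ^ ?v * 4 ^ ?v" by (simp flip: power_mult_distrib)
    then have "exp 1 * (q ^ ?k * exp (- ((real \<Delta> + 1 + \<Lambda>) * j)) * (3 * real n) ^ ?v) *
        (4 ^ ?v * ((K * \<Lambda>) ^ ?k * exp (real \<Delta> * (real j + 1)))) =
      (exp 1 * exp (- ((real \<Delta> + 1 + \<Lambda>) * j)) * exp (real \<Delta> * (real j + 1))) *
        (n * (n * q) ^ ?k * (12 ^ ?v * K ^ ?k) * \<Lambda> ^ ?k)"
      by (simp add: tree[symmetric] power_mult_distrib)
    then show ?thesis unfolding e by (simp add: mult_ac)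
  qed
  also have "\<dots> \<le> n * (n * q) ^ ?k * (12 ^ ?v * K ^ ?v * exp (real \<Delta> + 1)) * exp (- real j) * 1"
  proof (intro mult_mono)
    show "K ^ ?k \<le> K ^ ?v" using K_ge tree by (intro power_increasing) auto
    show "\<Lambda> ^ ?k * exp (- (\<Lambda> * j)) \<le> 1"
      using j
    proof
      assume "?v \<le> j"
      have "\<Lambda> ^ ?k \<le> \<Lambda> ^ j" using \<open>?v \<le> j\<close> tree \<Lambda>_ge by (intro power_increasing) auto
      also have "\<dots> \<le> exp \<Lambda> ^ j"
        using \<Lambda>_ge exp_ge_add_one_self[of \<Lambda>] by (intro power_mono) linarith+
      finally show ?thesis by (simp add: exp_minus field_simps flip: exp_of_nat_mult)
    qed auto
  qed (use q K_ge \<Lambda>_ge in \<open>auto intro!: mult_nonneg_nonneg\<close>)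
  finally show ?thesis by (simp add: power_mult_distrib)
qed

text \<open>If \<open>n * q > 1\<close>, then \<open>\<Lambda> = n * q\<close>, and growing the tree
  settles the levels up to \<open>card (verts F)\<close>; the higher ones are cut into unit
  intervals. If \<open>\<Lambda> = 1\<close>, growing alone would miss the possibly small factor
  \<open>(n * q) ^ card (edges F)\<close>, so every level goes through
  \<open>card_level_le\<close>.\<close>

lemma card_embeddings_le:
  "card (embeddings F H) \<le> n * (n * q) ^ card (edges F) * (36 * K * exp (real \<Delta> + 1)) ^ card (verts F)"
proof -
  let ?v = "card (verts F)" and ?k = "card (edges F)"
  let ?N = "n * (n * q) ^ ?k" and ?c = "(12 * K) ^ ?v * exp (real \<Delta> + 1)"
  let ?low = "{\<phi> \<in> embeddings F H. 1 < \<Lambda> \<and> level \<phi> \<le> ?v}"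
  let ?A = "\<lambda>j::nat. {\<phi> \<in> embeddings F H. j \<le> level \<phi> \<and> level \<phi> \<le> real j + 1}"
  define J where "J = {j \<in> (\<lambda>\<phi>. nat \<lfloor>level \<phi>\<rfloor>) ` embeddings F H. \<Lambda> = 1 \<or> ?v \<le> j}"
  have finJ: "finite J" using fin_emb by (simp add: J_def)
  have "embeddings F H \<subseteq> ?low \<union> (\<Union>j\<in>J. ?A j)"
  proof
    fix \<phi> assume p: "\<phi> \<in> embeddings F H"
    let ?j = "nat \<lfloor>level \<phi>\<rfloor>"
    have A: "\<phi> \<in> ?A ?j" using p level_nonneg[of \<phi>] by (simp add: of_nat_nat)
    show "\<phi> \<in> ?low \<union> (\<Union>j\<in>J. ?A j)"
    proof (cases "1 < \<Lambda> \<and> level \<phi> \<le> ?v")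
      case False
      then have "\<Lambda> = 1 \<or> ?v \<le> ?j" using \<Lambda>_ge level_nonneg[of \<phi>] by (auto simp: le_nat_floor)
      then have "?j \<in> J" using p by (auto simp: J_def)
      then show ?thesis using A by blast
    qed (use p in auto)
  qed
  then have "card (embeddings F H) \<le> card (?low \<union> (\<Union>j\<in>J. ?A j))"
    using fin_emb finJ by (intro card_mono) auto
  also have "\<dots> \<le> card ?low + (\<Sum>j\<in>J. card (?A j))"
    using card_Un_le[of ?low "\<Union>j\<in>J. ?A j"] card_UN_le[OF finJ, of ?A] by linarith
  finally have "real (card (embeddings F H)) \<le> card ?low + (\<Sum>j\<in>J. real (card (?A j)))"
    by (simp flip: of_nat_sum of_nat_add)
  also have "\<dots> \<le> ?N * (K ^ ?v * exp (real \<Delta> * ?v)) + ?N * ?c * 2"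
  proof (rule add_mono)
    show "card ?low \<le> ?N * (K ^ ?v * exp (real \<Delta> * ?v))"
    proof (cases "1 < \<Lambda>")
      case True
      then have L: "\<Lambda> = n * q" by (auto simp: \<Lambda>_def)
      have "card ?low \<le> n * ((K * \<Lambda>) ^ ?k * exp (real \<Delta> * ?v))"
        using True card_low_level_le[of ?v] by simp
      also have "\<dots> = ?N * (K ^ ?k * exp (real \<Delta> * ?v))"
        by (simp add: power_mult_distrib L mult_ac)
      also have "\<dots> \<le> ?N * (K ^ ?v * exp (real \<Delta> * ?v))"
        using K_ge tree q by (intro mult_left_mono mult_right_mono power_increasing) auto
      finally show ?thesis .
    qed (use q K_ge in auto)
    have "(\<Sum>j\<in>J. real (card (?A j))) \<le> (\<Sum>j\<in>J. ?N * ?c * exp (- real j))"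
      by (intro sum_mono card_level_le) (auto simp: J_def)
    also have "\<dots> \<le> ?N * ?c * 2"
      unfolding sum_distrib_left[symmetric]
      using q K_ge by (intro mult_left_mono sum_exp_neg_nat_le finJ) auto
    finally show "(\<Sum>j\<in>J. real (card (?A j))) \<le> ?N * ?c * 2" .
  qed
  also have "\<dots> \<le> ?N * (12 * K * exp (real \<Delta> + 1)) ^ ?v + ?N * (12 * K * exp (real \<Delta> + 1)) ^ ?v * 2"
  proof -
    have v: "1 \<le> ?v" using tree by linarith
    have "K ^ ?v * exp (real \<Delta> * ?v) = (K * exp (real \<Delta>)) ^ ?v"
      by (simp add: power_mult_distrib mult.commute flip: exp_of_nat_mult)
    also have "\<dots> \<le> (12 * K * exp (real \<Delta> + 1)) ^ ?v"
      using K_ge by (intro power_mono mult_mono) auto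
    finally have 1: "K ^ ?v * exp (real \<Delta> * ?v) \<le> (12 * K * exp (real \<Delta> + 1)) ^ ?v" .
    have "exp (real \<Delta> + 1) ^ 1 \<le> exp (real \<Delta> + 1) ^ ?v" by (intro power_increasing v) auto
    then have 2: "?c \<le> (12 * K * exp (real \<Delta> + 1)) ^ ?v"
      using K_ge by (simp add: power_mult_distrib mult_left_mono)
    show ?thesis using 1 2 q by (intro add_mono mult_left_mono mult_right_mono) auto
  qed
  also have "\<dots> = ?N * (12 * K * exp (real \<Delta> + 1)) ^ ?v * 3" by simp
  \<comment> \<open>The factor 3 is absorbed into the base, turning 12 into 36.\<close>
  also have "\<dots> \<le> ?N * (12 * K * exp (real \<Delta> + 1)) ^ ?v * 3 ^ ?v"
  proof -
    have "(3::real) ^ 1 \<le> 3 ^ ?v" using tree by (intro power_increasing) auto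
    then show ?thesis using q K_ge by (intro mult_left_mono) auto
  qed
  also have "\<dots> = ?N * (36 * K * exp (real \<Delta> + 1)) ^ ?v"
  proof -
    have eq: "36 * K * exp (real \<Delta> + 1) = 12 * K * exp (real \<Delta> + 1) * 3" by simp
    show ?thesis unfolding eq power_mult_distrib[of _ 3] by (simp only: mult.assoc)
  qed
  finally show ?thesis .
qed

end

section \<open>Choice of the constant and comparison with the complete graph\<close>

theorem theorem1p5:
  fixes \<Delta> :: nat
  assumes "\<Delta> \<ge> 1"
  shows "\<exists>L::real. L > 0 \<and>
    (\<forall>(n::nat) (q::real) (p::real) (H::nat ugraph) (F::nat ugraph).
       0 < q \<and> q \<le> 1 \<and>
       subgraph H (complete_ugraph n) \<and> q_sparse n q H \<and>
       p = L * q \<and>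
       is_tree F \<and> max_degree F = \<Delta> \<and> card (verts F) \<le> n \<longrightarrow>
       real (num_copies H F) < expected_copies n p F)"
proof -
  \<comment> \<open>\<open>C\<close> is the base from \<open>card_embeddings_le\<close>; the factor
    \<open>exp 1\<close> in \<open>D\<close> is the loss per vertex in
    \<open>card_embeddings_complete_ge\<close>.\<close>
  define C where "C = 36 * (1024 * (real \<Delta> + 2)) * exp (real \<Delta> + 1)"
  define D where "D = exp 1 * C + 1"
  have C: "0 < C" by (simp add: C_def)
  have D: "1 \<le> D" "exp 1 * C < D" "0 < D" using C by (auto simp: D_def add_pos_pos)
  show ?thesis
  \<comment> \<open>The estimates lose a constant per vertex, whereas \<open>p\<close> gains one per
    edge. A tree with an edge has at most two vertices per edge, hence the square.\<close>
  proof (intro exI[of _ "D\<^sup>2"] conjI allI impI; (elim conjE)?)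
    show "0 < D\<^sup>2" using D by simp
    fix n :: nat and q p :: real and H F :: "nat ugraph"
    assume q: "0 < q" "q \<le> 1" and H: "subgraph H (complete_ugraph n)" "q_sparse n q H"
      and p: "p = D\<^sup>2 * q" and F: "is_tree F" "max_degree F = \<Delta>" and le: "card (verts F) \<le> n"
    let ?v = "card (verts F)" and ?k = "card (edges F)" and ?Kn = "complete_ugraph n"
    have sF: "simple_graph F" "connected_graph F" using F by (auto simp: is_tree_def)
    have finF: "finite (verts F)" "verts F \<noteq> {}"
      using sF by (auto simp: simple_graph_def connected_graph_def)
    have tree: "Suc ?k = ?v" by (rule tree_card_edges[OF F(1)])
    have deg: "vertex_degree F x \<le> \<Delta>" if "x \<in> verts F" for x
      using that finF F(2) by (auto simp: max_degree_def intro!: Max_ge)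
    \<comment> \<open>The maximum degree is attained and positive, so \<open>F\<close> has an edge;
      this gives \<open>?v \<le> 2 * ?k\<close> below.\<close>
    have "\<Delta> \<in> vertex_degree F ` verts F"
      using finF F(2) Max_in[of "vertex_degree F ` verts F"] by (simp add: max_degree_def)
    then obtain x where "1 \<le> vertex_degree F x" using assms by auto
    then have "edges F \<noteq> {}" by (auto simp: vertex_degree_def)
    then have k: "1 \<le> ?k" using finite_edges[OF sF(1)] by (simp add: Suc_le_eq card_gt_0_iff)
    interpret sparse_tree_host F H n \<Delta> q
      by unfold_locales (use sF tree deg H q in auto)
    have host_simple: "simple_graph H" using H(1) by (simp add: subgraph_def)
    define a where "a = card (isos F F)"
    have embK: "real n ^ ?v \<le> exp ?v * card (embeddings F ?Kn)"
      by (rule card_embeddings_complete_ge[OF sF(1) le])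
    have n: "0 < n" using le tree by simp
    then have "0 < real n ^ ?v" by simp
    then have "0 < exp ?v * real (card (embeddings F ?Kn))" using embK by linarith
    then have "0 < card (embeddings F ?Kn)" by (simp add: zero_less_mult_iff)
    then have pos: "0 < num_copies ?Kn F" "0 < a"
      using card_embeddings[OF sF(1) simple_complete_ugraph, of n] by (auto simp: a_def)
    \<comment> \<open>Multiplied by the number \<open>a\<close> of automorphisms, both sides become
      counts of embeddings.\<close>
    have "real (num_copies H F) * a = card (embeddings F H)"
      using card_embeddings[OF sF(1) host_simple] by (simp add: a_def)
    also have "\<dots> \<le> n * (n * q) ^ ?k * C ^ ?v"
      using card_embeddings_le by (simp add: C_def K_def)
    also have "\<dots> = real n ^ ?v * (q ^ ?k * C ^ ?v)"
      by (simp add: tree[symmetric] power_mult_distrib)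
    also have "\<dots> \<le> exp ?v * card (embeddings F ?Kn) * (q ^ ?k * C ^ ?v)"
      using embK q C by (intro mult_right_mono) auto
    also have "\<dots> = num_copies ?Kn F * q ^ ?k * a * (exp 1 * C) ^ ?v"
      by (simp add: card_embeddings[OF sF(1) simple_complete_ugraph] a_def power_mult_distrib
          flip: exp_of_nat_mult)
    also have "\<dots> < num_copies ?Kn F * q ^ ?k * a * (D\<^sup>2) ^ ?k"
    proof (rule mult_strict_left_mono)
      have "(exp 1 * C) ^ ?v < D ^ ?v" using D C tree by (intro power_strict_mono) auto
      also have "\<dots> \<le> D ^ (2 * ?k)" using D tree k by (intro power_increasing) auto
      finally show "(exp 1 * C) ^ ?v < (D\<^sup>2) ^ ?k" by (simp add: power_mult)
    qed (use pos q in auto)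
    also have "\<dots> = expected_copies n p F * a"
      by (simp add: expected_copies_def p power_mult_distrib)
    finally show "real (num_copies H F) < expected_copies n p F" using pos by simp
  qed
qed

end
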